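(* Let $q$ be an odd prime power. The branching matrix of the group $GT_3(\mathbf{F}_q)$ of invertible upper triangular $3\times 3$ matrices, with types written in the order $\{C,A_1,A_2,B_1,R_1,R_2,R_3\}$, is $$B_{GT_3(\mathbf{F}_q)}=\begin{pmatrix} q-1&0&0&0&0&0&0\\ 2(q-1)&q(q-1)&0&0&0&0&0\\ q-1&0&q(q-1)&0&0&0&0\\ 3(q-1)(q-2)&0&0&(q-1)^2&0&0&0\\ q-1&q(q-1)&q^2-1&0&(q-1)q^2&0&0\\ 3(q-1)(q-2)&q(q-1)(q-2)&q(q-1)(q-2)&(q-1)^2&0&(q-1)^2q&0\\ (q-1)(q-2)(q-3)&0&0&(q-1)^2(q-2)&0&0&(q-1)^3 \end{pmatrix}.$$ In particular every commuting tuple of elements of $GT_3(\mathbf{F}_q)$ has one of these seven types.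
   Context: $\mathbf{F}_q$ is the finite field with $q$ elements, $q$ odd. For a finite group $G$ and a commuting tuple $(g_1,\dots,g_k)$ of elements of $G$ ($k\ge 1$), $Z_G(g_1,\dots,g_k)$ denotes its simultaneous centralizer in $G$. Two commuting tuples (possibly of different lengths) are of the same type if their simultaneous centralizers are isomorphic groups. If $(g_1,\dots,g_k)$ is a commuting tuple with $Z=Z_G(g_1,\dots,g_k)$, a branch of it is a $Z$-conjugacy class of elements $h\in Z$; the type of the branch is the type of the tuple $(g_1,\dots,g_k,h)$, i.e. it is determined by the centralizer $Z_Z(h)$. The branching matrix $B_G$ has rows and columns indexed by the types of commuting tuples; its entry in row $s$, column $t$ is the number of branches of type $s$ of any commuting tuple of type $t$. Types for $G=GT_3(\mathbf{F}_q)$, given by the isomorphism class of the centralizer (parameters $x_0,y_0,z_0$ range over $\mathbf{F}_q^*$, all other parameters over $\mathbf{F}_q$, blank entries are $0$): $C$: the whole group $GT_3(\mathbf{F}_q)$; $A_1$: $\left\{\begin{pmatrix}x_0&x_1&x_2\\&x_0&\\&&z_0\end{pmatrix}\right\}$ (the centralizer of $aI_3+E_{12}$); $A_2$: $\left\{\begin{pmatrix}x_0&x_1&x_2\\&y_0&y_1\\&&x_0\end{pmatrix}\right\}$ (the centralizer of $aI_3+E_{13}$); $B_1$: $\left\{\begin{pmatrix}x_0&x_1&\\&y_0&\\&&z_0\end{pmatrix}\right\}$ (the centralizer of $\mathrm{diag}(a,a,b)$, $a\ne b$); $R_1$: $\left\{\begin{pmatrix}x_0&x_1&x_2\\&x_0&x_1\\&&x_0\end{pmatrix}\right\}$,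 of order $(q-1)q^2$; $R_2$: $\left\{\begin{pmatrix}x_0&x_1&\\&x_0&\\&&z_0\end{pmatrix}\right\}$, of order $(q-1)^2q$; $R_3$: the group of invertible diagonal matrices, of order $(q-1)^3$. Here $a,b\in\mathbf{F}_q^*$ and $E_{ij}$ is the elementary matrix with $1$ in position $(i,j)$. *)

theory Defs
  imports
    "Jordan_Normal_Form.Matrix"
    "HOL-Algebra.Group_Action"
    "HOL-Library.Cardinality"
begin

definition centralizer :: "('a, 'b) monoid_scheme \<Rightarrow> 'a set \<Rightarrow> 'a set" where
  "centralizer G S = {x \<in> carrier G. \<forall>g\<in>S. x \<otimes>\<^bsub>G\<^esub> g = g \<otimes>\<^bsub>G\<^esub> x}"

definition conj_class :: "('a, 'b) monoid_scheme \<Rightarrow> 'a \<Rightarrow> 'a set" where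
  "conj_class G h = orbit G (\<lambda>x h. x \<otimes>\<^bsub>G\<^esub> h \<otimes>\<^bsub>G\<^esub> inv\<^bsub>G\<^esub> x) h"

definition commuting_tuple :: "('a, 'b) monoid_scheme \<Rightarrow> 'a list \<Rightarrow> bool" where
  "commuting_tuple G gs \<longleftrightarrow> gs \<noteq> [] \<and> set gs \<subseteq> carrier G \<and>
     (\<forall>x\<in>set gs. \<forall>y\<in>set gs. x \<otimes>\<^bsub>G\<^esub> y = y \<otimes>\<^bsub>G\<^esub> x)"

definition tuple_centralizer ::
    "('a, 'b) monoid_scheme \<Rightarrow> 'a list \<Rightarrow> ('a, 'b) monoid_scheme" where
  "tuple_centralizer G gs = G\<lparr>carrier := centralizer G (set gs)\<rparr>"

text \<open>Tuples have the same type iff their centralizers are isomorphic groups, so a type is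
  represented by a subgroup \<open>H\<close> of \<open>G\<close>, taken up to isomorphism.\<close>

definition has_type :: "('a, 'b) monoid_scheme \<Rightarrow> 'a list \<Rightarrow> 'a set \<Rightarrow> bool" where
  "has_type G gs H \<longleftrightarrow> tuple_centralizer G gs \<cong> G\<lparr>carrier := H\<rparr>"

text \<open>The set consists of conjugacy classes, not of elements, so its cardinality is the number
  of branches.\<close>

definition branches_of_type ::
    "('a, 'b) monoid_scheme \<Rightarrow> 'a list \<Rightarrow> 'a set \<Rightarrow> 'a set set" where
  "branches_of_type G gs H =
     {conj_class (tuple_centralizer G gs) h | h.
        h \<in> centralizer G (set gs) \<and> has_type G (gs @ [h]) H}"

definition lists_types :: "('a, 'b) monoid_scheme \<Rightarrow> 'a set list \<Rightarrow> bool" where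
  "lists_types G Ts \<longleftrightarrow>
     (\<forall>H\<in>set Ts. \<exists>gs. commuting_tuple G gs \<and> has_type G gs H) \<and>
     (\<forall>gs. commuting_tuple G gs \<longrightarrow> (\<exists>H\<in>set Ts. has_type G gs H)) \<and>
     (\<forall>i<length Ts. \<forall>j<length Ts. i \<noteq> j \<longrightarrow>
        \<not> G\<lparr>carrier := Ts ! i\<rparr> \<cong> G\<lparr>carrier := Ts ! j\<rparr>)"

text \<open>A relation rather than a function: that the number of branches of type \<open>s\<close> is the same for
  all tuples of type \<open>t\<close> is part of what is asserted.\<close>

definition is_branching_matrix ::
    "('a, 'b) monoid_scheme \<Rightarrow> 'a set list \<Rightarrow> int mat \<Rightarrow> bool" where
  "is_branching_matrix G Ts B \<longleftrightarrow>
     lists_types G Ts \<and> B \<in> carrier_mat (length Ts) (length Ts) \<and>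
     (\<forall>s<length Ts. \<forall>t<length Ts. \<forall>gs.
        commuting_tuple G gs \<and> has_type G gs (Ts ! t) \<longrightarrow>
        int (card (branches_of_type G gs (Ts ! s))) = B $$ (s, t))"

definition GT :: "nat \<Rightarrow> 'a::field mat monoid" where
  "GT n = \<lparr>carrier = {A \<in> carrier_mat n n. upper_triangular A \<and> invertible_mat A},
           mult = (*), one = 1\<^sub>m n\<rparr>"

definition type_C :: "'a::field mat set" where
  "type_C = carrier (GT 3)"

definition type_A1 :: "'a::field mat set" where
  "type_A1 = {mat_of_rows_list 3 [[x0, x1, x2],
                                  [0,  x0, 0 ],
                                  [0,  0,  z0]] | x0 x1 x2 z0. x0 \<noteq> 0 \<and> z0 \<noteq> 0}"

definition type_A2 :: "'a::field mat set" where
  "type_A2 = {mat_of_rows_list 3 [[x0, x1, x2],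
                                  [0,  y0, y1],
                                  [0,  0,  x0]] | x0 x1 x2 y0 y1. x0 \<noteq> 0 \<and> y0 \<noteq> 0}"

definition type_B1 :: "'a::field mat set" where
  "type_B1 = {mat_of_rows_list 3 [[x0, x1, 0 ],
                                  [0,  y0, 0 ],
                                  [0,  0,  z0]] | x0 x1 y0 z0. x0 \<noteq> 0 \<and> y0 \<noteq> 0 \<and> z0 \<noteq> 0}"

definition type_R1 :: "'a::field mat set" where
  "type_R1 = {mat_of_rows_list 3 [[x0, x1, x2],
                                  [0,  x0, x1],
                                  [0,  0,  x0]] | x0 x1 x2. x0 \<noteq> 0}"

definition type_R2 :: "'a::field mat set" where
  "type_R2 = {mat_of_rows_list 3 [[x0, x1, 0 ],
                                  [0,  x0, 0 ],
                                  [0,  0,  z0]] | x0 x1 z0. x0 \<noteq> 0 \<and> z0 \<noteq> 0}"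

definition type_R3 :: "'a::field mat set" where
  "type_R3 = {mat_of_rows_list 3 [[x0, 0,  0 ],
                                  [0,  y0, 0 ],
                                  [0,  0,  z0]] | x0 y0 z0. x0 \<noteq> 0 \<and> y0 \<noteq> 0 \<and> z0 \<noteq> 0}"

end

theory Submission
  imports Defs "Jordan_Normal_Form.Determinant"
begin

text \<open>
  The branches of a commuting tuple depend only on its centralizer \<open>Z\<close> as an abstract group: for
  \<open>h\<close> in \<open>Z\<close> the centralizer of the extended tuple is the centralizer of \<open>h\<close> in \<open>Z\<close>, and an isomorphism
  of \<open>Z\<close> with a model group carries it to the centralizer of the image of \<open>h\<close>. So only the
  seven model groups have to be examined, and in each of them only the centralizers of single
  elements. If these are again isomorphic to model groups, then every commuting tuple has one of the
  seven types. If moreover the orders of the model groups differ, then the type of \<open>h\<close> is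
  visible in the order of its centralizer, and by the orbit-stabilizer theorem every class of type
  \<open>s\<close> in the \<open>t\<close>-th group \<open>H t\<close> has \<open>card (H t) / card (H s)\<close> elements. The entry of the branching
  matrix is therefore the number of elements of \<open>H t\<close> whose centralizer is isomorphic to \<open>H s\<close>,
  multiplied by \<open>card (H s) / card (H t)\<close>. This is \<open>is_branching_matrixI\<close>, which holds for any
  finite group.

  For the triangular group the elements are sorted by coincidences among their diagonal
  entries. Where two diagonal entries differ, the entry of a commuting matrix at the corresponding
  position is determined by the other entries, and a polynomial change of coordinates identifies
  the centralizer with one of the model groups. Scalar multiples of unipotent matrices need more
  care. For regular ones, and for some elements of \<open>A\<^sub>1\<close> and \<open>A\<^sub>2\<close>, the centralizer is commutative
  and resembles \<open>R\<^sub>1\<close> except for the coefficient of a symmetric bilinear term in the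
  multiplication. That coefficient is adjusted by completing the square, which requires \<open>q\<close> to be
  odd (\<open>coord_iso_R1\<close>).
  The list of all cases is \<open>branch_table\<close>; that its entries are correct, exhaustive and of the right
  size is \<open>cent_branch_table\<close>, \<open>branch_table_covers\<close> and \<open>branch_table_count\<close>.
\<close>

section \<open>Branching in finite groups\<close>

lemma centralizer_subgroup:
  fixes G (structure)
  assumes "group G" and "S \<subseteq> carrier G"
  shows "subgroup (centralizer G S) G"
proof -
  interpret group G by fact
  show ?thesis
  proof (rule subgroupI)
    show "centralizer G S \<subseteq> carrier G" by (auto simp: centralizer_def)
    have "\<one> \<in> centralizer G S" using assms(2) by (auto simp: centralizer_def)
    then show "centralizer G S \<noteq> {}" by blast
  next
    fix a assume a: "a \<in> centralizer G S"
    then have ac: "a \<in> carrier G" by (simp add: centralizer_def)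
    have "inv a \<otimes> g = g \<otimes> inv a" if "g \<in> S" for g
    proof -
      have g: "g \<in> carrier G" using that assms(2) by blast
      have "a \<otimes> g = g \<otimes> a" using a that by (simp add: centralizer_def)
      then show ?thesis using ac g by (metis inv_closed inv_solve_left inv_solve_right m_assoc m_closed)
    qed
    then show "inv a \<in> centralizer G S" using ac by (simp add: centralizer_def)
  next
    fix a b assume a: "a \<in> centralizer G S" and b: "b \<in> centralizer G S"
    then have ac: "a \<in> carrier G" "b \<in> carrier G" by (simp_all add: centralizer_def)
    have "a \<otimes> b \<otimes> g = g \<otimes> (a \<otimes> b)" if "g \<in> S" for g
    proof -
      have g: "g \<in> carrier G" using that assms(2) by blast
      have "a \<otimes> g = g \<otimes> a" "b \<otimes> g = g \<otimes> b" using a b that by (simp_all add: centralizer_def)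
      then show ?thesis using ac g by (metis m_assoc)
    qed
    then show "a \<otimes> b \<in> centralizer G S" using ac by (simp add: centralizer_def)
  qed
qed

text \<open>The library's conjugation action is restricted to the carrier, whereas the action that
  defines \<^const>\<open>conj_class\<close> is not; on elements of the group the orbits agree.\<close>

lemma conj_class_eq_orbit:
  assumes "h \<in> carrier G"
  shows "conj_class G h
    = orbit G (\<lambda>g. \<lambda>h \<in> carrier G. g \<otimes>\<^bsub>G\<^esub> h \<otimes>\<^bsub>G\<^esub> inv\<^bsub>G\<^esub> g) h"
  using assms by (auto simp: conj_class_def orbit_def)

text \<open>Orbit-stabilizer: for the conjugation action the stabilizer is the centralizer.\<close>

lemma card_conj_class:
  assumes "group Z" and "finite (carrier Z)" and h: "h \<in> carrier Z"
  shows "card (conj_class Z h) * card (centralizer Z {h}) = card (carrier Z)"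
proof -
  interpret group Z by fact
  interpret act: group_action Z "carrier Z" "\<lambda>g. \<lambda>h \<in> carrier Z. g \<otimes>\<^bsub>Z\<^esub> h \<otimes>\<^bsub>Z\<^esub> inv\<^bsub>Z\<^esub> g"
    by (rule action_by_conjugation)
  have "stabilizer Z (\<lambda>g. \<lambda>h \<in> carrier Z. g \<otimes>\<^bsub>Z\<^esub> h \<otimes>\<^bsub>Z\<^esub> inv\<^bsub>Z\<^esub> g) h = centralizer Z {h}"
    using h by (auto simp: stabilizer_def centralizer_def m_assoc inv_solve_right)
       (metis inv_closed inv_solve_right' m_assoc m_closed)+
  then show ?thesis
    using act.orbit_stabilizer_theorem[OF h] conj_class_eq_orbit[OF h] by (simp add: Coset.order_def)
qed

text \<open>The elements with centralizer of order \<open>n\<close> form a union of conjugacy classes, all of the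
  same size \<open>card (carrier Z) / n\<close>. Counting classes is thereby reduced to counting elements;
  the equation is kept free of division.\<close>

lemma card_conj_classes:
  assumes Z: "group Z" and fin: "finite (carrier Z)"
  shows "card {conj_class Z h | h. h \<in> carrier Z \<and> card (centralizer Z {h}) = n} * card (carrier Z)
    = card {h \<in> carrier Z. card (centralizer Z {h}) = n} * n"
proof -
  interpret group Z by fact
  interpret act: group_action Z "carrier Z" "\<lambda>g. \<lambda>h \<in> carrier Z. g \<otimes>\<^bsub>Z\<^esub> h \<otimes>\<^bsub>Z\<^esub> inv\<^bsub>Z\<^esub> g"
    by (rule action_by_conjugation)
  define S where "S = {h \<in> carrier Z. card (centralizer Z {h}) = n}"
  have classes: "conj_class Z ` carrier Z
    = orbits Z (carrier Z) (\<lambda>g. \<lambda>h \<in> carrier Z. g \<otimes>\<^bsub>Z\<^esub> h \<otimes>\<^bsub>Z\<^esub> inv\<^bsub>Z\<^esub> g)"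
    by (auto simp: orbits_def conj_class_eq_orbit)
  have mem: "h \<in> conj_class Z h" if "h \<in> carrier Z" for h
    using act.orbit_refl[OF that] by (simp add: conj_class_eq_orbit that)
  have sub: "conj_class Z h \<subseteq> carrier Z" if "h \<in> carrier Z" for h
    using that by (auto simp: conj_class_def orbit_def)
  have disj: "conj_class Z g = conj_class Z h \<or> conj_class Z g \<inter> conj_class Z h = {}"
    if "g \<in> carrier Z" "h \<in> carrier Z" for g h
    using act.disjoint_union[of "conj_class Z g" "conj_class Z h"] that classes by blast
  have pos: "card (conj_class Z h) > 0" if "h \<in> carrier Z" for h
    using mem[OF that] finite_subset[OF sub[OF that] fin] card_gt_0_iff by blast
  \<comment> \<open>Conjugate elements have classes of the same size, hence centralizers of the same order.\<close>
  have closed: "conj_class Z h \<subseteq> S" if "h \<in> S" for h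
  proof
    fix g assume g: "g \<in> conj_class Z h"
    have h: "h \<in> carrier Z" "card (centralizer Z {h}) = n" using that by (auto simp: S_def)
    then have gc: "g \<in> carrier Z" using g sub by blast
    then have "conj_class Z g = conj_class Z h" using disj[OF gc h(1)] mem[OF gc] g by blast
    then have "card (centralizer Z {g}) = card (centralizer Z {h})"
      using card_conj_class[OF Z fin gc] card_conj_class[OF Z fin h(1)] pos[OF h(1)]
      by (metis mult_cancel1 not_gr_zero)
    then show "g \<in> S" using gc h by (simp add: S_def)
  qed
  have Un: "\<Union>(conj_class Z ` S) = S"
    using closed mem by (auto simp: S_def)
  have finS: "finite S" using fin by (simp add: S_def)
  show ?thesis
  proof (cases "S = {}")
    case True
    then have none: "\<not> (h \<in> carrier Z \<and> card (centralizer Z {h}) = n)" for h by (auto simp: S_def)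
    have "{h \<in> carrier Z. card (centralizer Z {h}) = n} = {}"
      "{conj_class Z h | h. h \<in> carrier Z \<and> card (centralizer Z {h}) = n} = {}"
      using none by blast+
    then show ?thesis by (simp only: card.empty mult_0)
  next
    case False
    then obtain h0 where h0: "h0 \<in> S" by blast
    have same: "card (conj_class Z h) = card (conj_class Z h0)" if "h \<in> S" for h
    proof -
      have "card (conj_class Z h) * n = card (conj_class Z h0) * n"
        using card_conj_class[OF Z fin, of h] card_conj_class[OF Z fin, of h0] that h0
        by (auto simp: S_def)
      moreover have "n > 0"
      proof -
        have "card (conj_class Z h0) * n = card (carrier Z)"
          using card_conj_class[OF Z fin, of h0] h0 by (auto simp: S_def)
        moreover have "card (carrier Z) > 0" using fin card_gt_0_iff by blast
        ultimately show ?thesis by (metis mult_0_right not_gr_zero)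
      qed
      ultimately show ?thesis by simp
    qed
    have "card (conj_class Z h0) * card (conj_class Z ` S) = card (\<Union>(conj_class Z ` S))"
    proof (rule card_partition)
      show "c1 \<inter> c2 = {}" if "c1 \<in> conj_class Z ` S" "c2 \<in> conj_class Z ` S" "c1 \<noteq> c2" for c1 c2
        using that disj by (force simp: S_def)
    qed (use finS Un same in auto)
    then have "card (conj_class Z h0) * card (conj_class Z ` S) * n = card S * n"
      by (simp add: Un)
    moreover have "card (conj_class Z h0) * n = card (carrier Z)"
      using card_conj_class[OF Z fin, of h0] h0 by (auto simp: S_def)
    moreover have "{conj_class Z h | h. h \<in> carrier Z \<and> card (centralizer Z {h}) = n} = conj_class Z ` S"
      by (auto simp: S_def)
    ultimately show ?thesis by (metis S_def mult.assoc mult.commute)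
  qed
qed

text \<open>Adding \<open>h\<close> to a tuple with centralizer \<open>Z\<close> replaces \<open>Z\<close> by the centralizer of \<open>h\<close> in \<open>Z\<close>, so
  from here on only \<open>Z\<close> matters and the tuple itself can be forgotten.\<close>

lemma centralizer_append:
  assumes "h \<in> centralizer G (set gs)"
  shows "centralizer G (set (gs @ [h])) = centralizer (tuple_centralizer G gs) {h}"
  by (auto simp: tuple_centralizer_def centralizer_def)

lemma commuting_tuple_append:
  assumes "commuting_tuple G gs" and "h \<in> centralizer G (set gs)"
  shows "commuting_tuple G (gs @ [h])"
  using assms by (auto simp: commuting_tuple_def centralizer_def)

lemma centralizer_iso:
  assumes "group Z" and f: "f \<in> iso Z H" and h: "h \<in> carrier Z"
  shows "Z\<lparr>carrier := centralizer Z {h}\<rparr> \<cong> H\<lparr>carrier := centralizer H {f h}\<rparr>"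
proof -
  interpret group Z by fact
  have bij: "bij_betw f (carrier Z) (carrier H)" using f by (simp add: iso_def)
  have hom: "f (x \<otimes>\<^bsub>Z\<^esub> y) = f x \<otimes>\<^bsub>H\<^esub> f y" if "x \<in> carrier Z" "y \<in> carrier Z" for x y
    using f that by (auto simp: iso_def hom_def)
  have commute: "x \<otimes>\<^bsub>Z\<^esub> h = h \<otimes>\<^bsub>Z\<^esub> x \<longleftrightarrow> f x \<otimes>\<^bsub>H\<^esub> f h = f h \<otimes>\<^bsub>H\<^esub> f x"
    if "x \<in> carrier Z" for x
    using that h bij inj_on_eq_iff[of f "carrier Z" "x \<otimes>\<^bsub>Z\<^esub> h" "h \<otimes>\<^bsub>Z\<^esub> x"]
    by (simp add: hom[symmetric] bij_betw_def)
  have "f ` centralizer Z {h} = centralizer H {f h}"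
  proof (rule Set.set_eqI)
    fix y
    show "y \<in> f ` centralizer Z {h} \<longleftrightarrow> y \<in> centralizer H {f h}"
      using commute unfolding centralizer_def bij_betw_imp_surj_on[OF bij, symmetric] by auto
  qed
  moreover have "inj_on f (centralizer Z {h})"
    using bij by (auto simp: centralizer_def bij_betw_def inj_on_def)
  ultimately have "f \<in> iso (Z\<lparr>carrier := centralizer Z {h}\<rparr>) (H\<lparr>carrier := centralizer H {f h}\<rparr>)"
    using hom by (auto simp: iso_def hom_def bij_betw_def centralizer_def)
  then show ?thesis by (rule is_isoI)
qed

text \<open>An isomorphism of \<open>Z\<close> with a model \<open>H\<close> identifies the branches of the tuple with the classes
  of \<open>H\<close>; the type of a branch may be computed in \<open>H\<close>.\<close>

lemma has_type_append:
  assumes G: "group G" and gs: "commuting_tuple G gs"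
    and f: "f \<in> iso (tuple_centralizer G gs) (G\<lparr>carrier := H\<rparr>)"
    and h: "h \<in> centralizer G (set gs)"
    and iso: "G\<lparr>carrier := centralizer (G\<lparr>carrier := H\<rparr>) {f h}\<rparr> \<cong> G\<lparr>carrier := K\<rparr>"
  shows "has_type G (gs @ [h]) K"
proof -
  have "group (tuple_centralizer G gs)"
    unfolding tuple_centralizer_def
    using G gs by (intro group.subgroup_imp_group centralizer_subgroup) (auto simp: commuting_tuple_def)
  from centralizer_iso[OF this f] h
  have "tuple_centralizer G (gs @ [h]) \<cong> G\<lparr>carrier := centralizer (G\<lparr>carrier := H\<rparr>) {f h}\<rparr>"
    using centralizer_append[OF h] by (simp add: tuple_centralizer_def)
  then show ?thesis using iso unfolding has_type_def by (rule iso_trans)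
qed

text \<open>A criterion that mentions no tuples: it suffices to know the model groups \<open>Ts ! t\<close>. The set
  \<open>S s t\<close> collects the elements of \<open>Ts ! t\<close> whose centralizer in \<open>Ts ! t\<close> is isomorphic to \<open>Ts ! s\<close>.
  That these sets exhaust \<open>Ts ! t\<close> makes the list of types closed under extending tuples, and
  every commuting tuple arises by extension from the tuple of the identity, whose centralizer is
  \<open>Ts ! 0\<close>. As the model groups have different orders, the order of a centralizer determines its
  type, and each class of elements of \<open>S s t\<close> has \<open>card (Ts ! t) / card (Ts ! s)\<close> elements.
  The condition \<open>t < s\<close> in \<open>reach\<close> lets induction show that every type is realised.\<close>

lemma is_branching_matrixI:
  fixes G (structure) and S :: "nat \<Rightarrow> nat \<Rightarrow> 'a set"
  assumes G: "group G" and fin: "finite (carrier G)"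
    and Ts: "Ts \<noteq> []" "Ts ! 0 = carrier G" "\<And>t. t < length Ts \<Longrightarrow> Ts ! t \<subseteq> carrier G"
    and distinct: "distinct (map card Ts)"
    and part: "\<And>t. t < length Ts \<Longrightarrow> Ts ! t = (\<Union>s<length Ts. S s t)"
    and cent: "\<And>s t h. \<lbrakk>s < length Ts; t < length Ts; h \<in> S s t\<rbrakk> \<Longrightarrow>
      G\<lparr>carrier := centralizer (G\<lparr>carrier := Ts ! t\<rparr>) {h}\<rparr> \<cong> G\<lparr>carrier := Ts ! s\<rparr>"
    and reach: "\<And>s. \<lbrakk>0 < s; s < length Ts\<rbrakk> \<Longrightarrow> \<exists>t<s. S s t \<noteq> {}"
    and B: "B \<in> carrier_mat (length Ts) (length Ts)"
    and count: "\<And>s t. \<lbrakk>s < length Ts; t < length Ts\<rbrakk> \<Longrightarrow>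
      int (card (S s t)) * int (card (Ts ! s)) = B $$ (s, t) * int (card (Ts ! t))"
  shows "is_branching_matrix G Ts B"
proof -
  interpret group G by fact
  let ?n = "length Ts"
  have sub: "set gs \<subseteq> carrier G" if "commuting_tuple G gs" for gs
    using that by (auto simp: commuting_tuple_def)
  have card_eq: "card (centralizer G (set gs)) = card H" if "has_type G gs H" for gs H
    using iso_same_card that unfolding has_type_def tuple_centralizer_def by fastforce
  have card_inj: "s = s'" if "s < ?n" "s' < ?n" "card (Ts ! s) = card (Ts ! s')" for s s'
    using distinct that nth_eq_iff_index_eq[OF distinct, of s s'] by simp
  have extend: "has_type G (gs @ [h]) (Ts ! s)"
    if "commuting_tuple G gs" "f \<in> iso (tuple_centralizer G gs) (G\<lparr>carrier := Ts ! t\<rparr>)"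
      "h \<in> centralizer G (set gs)" "f h \<in> S s t" "s < ?n" "t < ?n" for gs f h s t
    using has_type_append[OF G that(1-3)] cent that by blast
  have image: "f ` centralizer G (set gs) = Ts ! t"
    if "f \<in> iso (tuple_centralizer G gs) (G\<lparr>carrier := Ts ! t\<rparr>)" for f gs t
    using that by (auto simp: iso_def bij_betw_def tuple_centralizer_def)
  have one: "has_type G [\<one>] (Ts ! 0)" "commuting_tuple G [\<one>]"
  proof -
    have "centralizer G {\<one>} = carrier G" by (auto simp: centralizer_def)
    then show "has_type G [\<one>] (Ts ! 0)"
      using Ts(2) by (simp add: has_type_def tuple_centralizer_def iso_refl)
  qed (auto simp: commuting_tuple_def)
  have realised: "\<exists>gs. commuting_tuple G gs \<and> has_type G gs (Ts ! s)" if "s < ?n" for s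
    using that
  proof (induction s rule: less_induct)
    case (less s)
    show ?case
    proof (cases "s = 0")
      case True
      then show ?thesis using one by blast
    next
      case False
      then obtain t h where t: "t < s" and h: "h \<in> S s t" using reach[of s] less.prems by blast
      then obtain gs f where gs: "commuting_tuple G gs"
        and f: "f \<in> iso (tuple_centralizer G gs) (G\<lparr>carrier := Ts ! t\<rparr>)"
        using less by (force simp: has_type_def is_iso_def)
      have "h \<in> f ` centralizer G (set gs)" using part[of t] h t less.prems by (auto simp: image[OF f])
      then obtain g where g: "g \<in> centralizer G (set gs)" "h = f g" by (rule imageE)
      have "f g \<in> S s t" "t < ?n" using g(2) h t less.prems by simp_all
      with extend[OF gs f g(1) _ less.prems] commuting_tuple_append[OF gs g(1)]
      show ?thesis by blast
    qed
  qed
  have exhausted: "\<exists>s<?n. has_type G gs (Ts ! s)" if "commuting_tuple G gs" for gs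
    using that
  proof (induction gs rule: rev_induct)
    case Nil
    then show ?case by (simp add: commuting_tuple_def)
  next
    case (snoc h gs)
    have h: "h \<in> centralizer G (set gs)" using snoc.prems unfolding commuting_tuple_def centralizer_def set_append list.set by blast
    \<comment> \<open>A one-element tuple extends the tuple of the identity.\<close>
    obtain hs where hs: "commuting_tuple G hs" "centralizer G (set (hs @ [h])) = centralizer G (set (gs @ [h]))"
      and "\<exists>t<?n. has_type G hs (Ts ! t)" and h': "h \<in> centralizer G (set hs)"
    proof (cases "gs = []")
      case True
      have "h \<in> carrier G" using snoc.prems by (auto simp: commuting_tuple_def)
      then have "h \<in> centralizer G (set [\<one>])"
        "centralizer G (set ([\<one>] @ [h])) = centralizer G (set (gs @ [h]))"
        using True by (auto simp: centralizer_def)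
      moreover have "\<exists>t<?n. has_type G [\<one>] (Ts ! t)" using one Ts(1) by blast
      ultimately show ?thesis using that one(2) by blast
    next
      case False
      then have "commuting_tuple G gs"
        using snoc.prems unfolding commuting_tuple_def set_append by blast
      then show ?thesis using that[of gs] snoc.IH h by blast
    qed
    then obtain t f where t: "t < ?n" and f: "f \<in> iso (tuple_centralizer G hs) (G\<lparr>carrier := Ts ! t\<rparr>)"
      by (auto simp: has_type_def is_iso_def)
    have "f h \<in> Ts ! t" using imageI[OF h', of f] by (simp only: image[OF f])
    then obtain s where "s < ?n" "f h \<in> S s t" using part[OF t] by auto
    then have "has_type G (hs @ [h]) (Ts ! s)" using extend[OF hs(1) f h'] t by blast
    then show ?case using hs(2) \<open>s < ?n\<close> by (auto simp: has_type_def tuple_centralizer_def)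
  qed
  have nth_noniso: "\<not> G\<lparr>carrier := Ts ! i\<rparr> \<cong> G\<lparr>carrier := Ts ! j\<rparr>" if "i < ?n" "j < ?n" "i \<noteq> j" for i j
    using iso_same_card[of "G\<lparr>carrier := Ts ! i\<rparr>" "G\<lparr>carrier := Ts ! j\<rparr>"] card_inj that by auto
  have "lists_types G Ts"
    unfolding lists_types_def using realised exhausted nth_noniso by (metis in_set_conv_nth)
  moreover have "int (card (branches_of_type G gs (Ts ! s))) = B $$ (s, t)"
    if s: "s < ?n" and t: "t < ?n" and gs: "commuting_tuple G gs" and ty: "has_type G gs (Ts ! t)"
    for s t gs
  proof -
    let ?Z = "tuple_centralizer G gs"
    let ?k = "card (Ts ! s)"
    obtain f where f: "f \<in> iso ?Z (G\<lparr>carrier := Ts ! t\<rparr>)" using ty by (auto simp: has_type_def is_iso_def)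
    have Z: "group ?Z" and finZ: "finite (carrier ?Z)"
    proof -
      show "group ?Z" unfolding tuple_centralizer_def
        by (intro subgroup_imp_group centralizer_subgroup G sub gs)
      show "finite (carrier ?Z)"
        using fin by (auto simp: tuple_centralizer_def centralizer_def)
    qed
    have carZ: "carrier ?Z = centralizer G (set gs)" by (simp add: tuple_centralizer_def)
    \<comment> \<open>Since the listed types have different orders, the order of the centralizer of \<open>h\<close>
      decides the type of the branch.\<close>
    have type_iff: "has_type G (gs @ [h]) (Ts ! s) \<longleftrightarrow> card (centralizer ?Z {h}) = ?k"
      "has_type G (gs @ [h]) (Ts ! s) \<longleftrightarrow> f h \<in> S s t"
      if h: "h \<in> centralizer G (set gs)" for h
    proof -
      have "f h \<in> Ts ! t" using imageI[OF h, of f] by (simp only: image[OF f])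
      then obtain s' where s': "s' < ?n" "f h \<in> S s' t" using part[OF t] by auto
      have ty': "has_type G (gs @ [h]) (Ts ! s')" by (rule extend[OF gs f h s'(2,1) t])
      have "card (centralizer ?Z {h}) = card (Ts ! s')"
        using card_eq[OF ty'] centralizer_append[OF h] by simp
      moreover have "card (centralizer ?Z {h}) = ?k" if "has_type G (gs @ [h]) (Ts ! s)"
        using card_eq[OF that] centralizer_append[OF h] by simp
      ultimately show "has_type G (gs @ [h]) (Ts ! s) \<longleftrightarrow> card (centralizer ?Z {h}) = ?k"
        "has_type G (gs @ [h]) (Ts ! s) \<longleftrightarrow> f h \<in> S s t"
        using ty' s s' card_inj extend[OF gs f h _ s t] by metis+
    qed
    have "branches_of_type G gs (Ts ! s)
        = {conj_class ?Z h | h. h \<in> carrier ?Z \<and> card (centralizer ?Z {h}) = ?k}"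
      using type_iff(1) by (auto simp: branches_of_type_def carZ)
    then have "card (branches_of_type G gs (Ts ! s)) * card (carrier ?Z)
        = card {h \<in> carrier ?Z. card (centralizer ?Z {h}) = ?k} * ?k"
      using card_conj_classes[OF Z finZ] by simp
    moreover have "{h \<in> carrier ?Z. card (centralizer ?Z {h}) = ?k} = {h \<in> carrier ?Z. f h \<in> S s t}"
      using type_iff carZ by auto
    moreover have "card {h \<in> carrier ?Z. f h \<in> S s t} = card (S s t)"
    proof (rule bij_betw_same_card[of f])
      have "S s t \<subseteq> Ts ! t" using part[OF t] s by auto
      then show "bij_betw f {h \<in> carrier ?Z. f h \<in> S s t} (S s t)"
        using f by (auto simp: iso_def bij_betw_def inj_on_def image_iff)
    qed
    moreover have "card (carrier ?Z) = card (Ts ! t)" using card_eq[OF ty] carZ by simp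
    ultimately have "int (card (branches_of_type G gs (Ts ! s))) * int (card (Ts ! t))
        = B $$ (s, t) * int (card (Ts ! t))"
      using count[OF s t] by (metis of_nat_mult)
    moreover have "card (Ts ! t) > 0"
    proof -
      have "card (carrier ?Z) > 0" using finZ group.is_monoid[OF Z] monoid.one_closed card_gt_0_iff by blast
      then show ?thesis using card_eq[OF ty] carZ by simp
    qed
    ultimately show ?thesis by simp
  qed
  ultimately show ?thesis using B unfolding is_branching_matrix_def by blast
qed

section \<open>Coordinates on the triangular group\<close>

text \<open>The coordinates are the entries on and above the diagonal, row by row. Working with tuples
  and an explicit product keeps matrices out of the computations.\<close>

type_synonym 'a ut_coords = "'a \<times> 'a \<times> 'a \<times> 'a \<times> 'a \<times> 'a"

definition ut :: "'a::field ut_coords \<Rightarrow> 'a mat" where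
  "ut = (\<lambda>(x0, x1, x2, y0, y1, z0). mat_of_rows_list 3 [[x0, x1, x2], [0, y0, y1], [0, 0, z0]])"

fun ut_mult :: "'a::field ut_coords \<Rightarrow> 'a ut_coords \<Rightarrow> 'a ut_coords" where
  "ut_mult (x0, x1, x2, y0, y1, z0) (a, b, c, d, e, f) =
     (x0 * a, x0 * b + x1 * d, x0 * c + x1 * e + x2 * f, y0 * d, y0 * e + y1 * f, z0 * f)"

definition coords_C :: "'a::field ut_coords set" where
  "coords_C = {(x0, x1, x2, y0, y1, z0). x0 \<noteq> 0 \<and> y0 \<noteq> 0 \<and> z0 \<noteq> 0}"

lemma less3: "i < 3 \<longleftrightarrow> i = 0 \<or> i = 1 \<or> i = (2::nat)"
  by auto

lemma ut_dim [simp]: "dim_row (ut p) = 3" "dim_col (ut p) = 3"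
  by (simp_all add: ut_def mat_of_rows_list_def split: prod.split)

lemma ut_carrier: "ut p \<in> carrier_mat 3 3"
  by auto

lemma ut_index:
  "ut (x0, x1, x2, y0, y1, z0) $$ (0, 0) = x0"
  "ut (x0, x1, x2, y0, y1, z0) $$ (0, 1) = x1"
  "ut (x0, x1, x2, y0, y1, z0) $$ (0, 2) = x2"
  "ut (x0, x1, x2, y0, y1, z0) $$ (1, 0) = 0"
  "ut (x0, x1, x2, y0, y1, z0) $$ (1, 1) = y0"
  "ut (x0, x1, x2, y0, y1, z0) $$ (1, 2) = y1"
  "ut (x0, x1, x2, y0, y1, z0) $$ (2, 0) = 0"
  "ut (x0, x1, x2, y0, y1, z0) $$ (2, 1) = 0"
  "ut (x0, x1, x2, y0, y1, z0) $$ (2, 2) = z0"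
  by (simp_all add: ut_def mat_of_rows_list_def)

declare ut_index [simp] ut_index [unfolded One_nat_def, simp]

lemma sum3: "sum g {0..<3} = g 0 + g 1 + g (2::nat)"
  by (simp add: numeral_3_eq_3 numeral_2_eq_2)

lemma ut_inj: "ut p = ut p' \<longleftrightarrow> p = p'"
proof
  assume eq: "ut p = ut p'"
  obtain x0 x1 x2 y0 y1 z0 where p: "p = (x0, x1, x2, y0, y1, z0)" by (cases p) auto
  obtain a b c d e f where p': "p' = (a, b, c, d, e, f)" by (cases p') auto
  show "p = p'" using eq unfolding p p' by (metis ut_index)
qed simp

lemma ut_times: "ut p * ut p' = ut (ut_mult p p')"
proof -
  obtain x0 x1 x2 y0 y1 z0 where p: "p = (x0, x1, x2, y0, y1, z0)" by (cases p) auto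
  obtain a b c d e f where p': "p' = (a, b, c, d, e, f)" by (cases p') auto
  show ?thesis unfolding p p'
  proof (rule eq_matI)
    fix i j assume "i < dim_row (ut (ut_mult (x0, x1, x2, y0, y1, z0) (a, b, c, d, e, f)))"
      "j < dim_col (ut (ut_mult (x0, x1, x2, y0, y1, z0) (a, b, c, d, e, f)))"
    then have "i = 0 \<or> i = 1 \<or> i = 2" "j = 0 \<or> j = 1 \<or> j = 2"
      by (simp_all only: ut_dim less3)
    then show "(ut (x0, x1, x2, y0, y1, z0) * ut (a, b, c, d, e, f)) $$ (i, j)
        = ut (ut_mult (x0, x1, x2, y0, y1, z0) (a, b, c, d, e, f)) $$ (i, j)"
      by (elim disjE) (simp_all add: scalar_prod_def sum3 ut_index)
  qed simp_all
qed

lemma one_ut: "1\<^sub>m 3 = ut (1, 0, 0, 1, 0, 1)"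
  by (rule eq_matI) (auto simp: less3 less_2_cases_iff)

lemma carrier_GT3: "carrier (GT 3) = ut ` (coords_C :: 'a::field ut_coords set)"
proof (rule Set.set_eqI)
  fix A :: "'a mat"
  show "A \<in> carrier (GT 3) \<longleftrightarrow> A \<in> ut ` coords_C"
  proof
    assume "A \<in> carrier (GT 3)"
    then have A: "A \<in> carrier_mat 3 3" and tri: "upper_triangular A" and inv: "invertible_mat A"
      by (auto simp: GT_def)
    let ?p = "(A $$ (0,0), A $$ (0,1), A $$ (0,2), A $$ (1,1), A $$ (1,2), A $$ (2,2))"
    have eq: "A = ut ?p"
    proof (rule eq_matI)
      fix i j assume "i < dim_row (ut ?p)" "j < dim_col (ut ?p)"
      then have "i = 0 \<or> i = 1 \<or> i = 2" "j = 0 \<or> j = 1 \<or> j = 2"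
        by (simp_all only: ut_dim less3)
      then show "A $$ (i, j) = ut ?p $$ (i, j)"
        using A tri by (elim disjE) (simp_all add: upper_triangular_def)
    qed (use A in simp_all)
    obtain B where "A * B = 1\<^sub>m (dim_row A)" and BA: "B * A = 1\<^sub>m (dim_row B)"
      using inv by (auto simp: invertible_mat_def inverts_mat_def)
    then have AB: "A * B = 1\<^sub>m 3" using A by auto
    have "dim_col B = 3" by (metis AB index_mult_mat(3) index_one_mat(3))
    moreover have "dim_row B = 3" using A by (metis BA carrier_matD(2) index_mult_mat(3) index_one_mat(3))
    ultimately have "B \<in> carrier_mat 3 3" by auto
    then have "det A * det B = 1" using det_mult[OF A, of B] AB by simp
    then have "det A \<noteq> 0" by auto
    moreover have "det A = prod_list (diag_mat A)"
      using tri A by (rule det_upper_triangular)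
    ultimately have "A $$ (0,0) \<noteq> 0 \<and> A $$ (1,1) \<noteq> 0 \<and> A $$ (2,2) \<noteq> 0"
      using A by (auto simp: diag_mat_def numeral_3_eq_3 numeral_2_eq_2)
    then show "A \<in> ut ` coords_C" using eq by (auto simp: coords_C_def)
  next
    assume "A \<in> ut ` coords_C"
    then obtain x0 x1 x2 y0 y1 z0 where A: "A = ut (x0, x1, x2, y0, y1, z0)"
      and nz: "x0 \<noteq> 0" "y0 \<noteq> 0" "z0 \<noteq> 0"
      by (auto simp: coords_C_def)
    let ?B = "ut (1 / x0, - x1 / (x0 * y0), (x1 * y1 - x2 * y0) / (x0 * y0 * z0), 1 / y0, - y1 / (y0 * z0), 1 / z0)"
    have "A * ?B = 1\<^sub>m 3" "?B * A = 1\<^sub>m 3"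
      unfolding A ut_times one_ut ut_inj using nz by (simp_all add: field_simps)
    then have "invertible_mat A"
      unfolding invertible_mat_def inverts_mat_def square_mat.simps A
      by (intro conjI exI[of _ ?B]) simp_all
    moreover have "upper_triangular A"
      unfolding A upper_triangular_def by (auto simp: less3 less_2_cases_iff)
    ultimately show "A \<in> carrier (GT 3)"
      using ut_carrier A by (simp add: GT_def)
  qed
qed

lemma GT_simps: "x \<otimes>\<^bsub>GT n\<^esub> y = x * y" "\<one>\<^bsub>GT n\<^esub> = 1\<^sub>m n"
  by (simp_all add: GT_def)

lemma GT3_group: "group (GT 3 :: 'a::field mat monoid)"
proof (rule groupI)
  fix x :: "'a mat" assume "x \<in> carrier (GT 3)"
  then obtain x0 x1 x2 y0 y1 z0 where x: "x = ut (x0, x1, x2, y0, y1, z0)"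
    and nz: "x0 \<noteq> 0" "y0 \<noteq> 0" "z0 \<noteq> 0"
    by (auto simp: carrier_GT3 coords_C_def)
  let ?p = "(1 / x0, - x1 / (x0 * y0), (x1 * y1 - x2 * y0) / (x0 * y0 * z0), 1 / y0, - y1 / (y0 * z0), 1 / z0)"
  have "ut ?p * x = 1\<^sub>m 3"
    unfolding x ut_times one_ut ut_inj using nz by (simp add: field_simps)
  moreover have "?p \<in> coords_C" using nz by (simp add: coords_C_def)
  ultimately show "\<exists>y\<in>carrier (GT 3). y \<otimes>\<^bsub>GT 3\<^esub> x = \<one>\<^bsub>GT 3\<^esub>"
    unfolding carrier_GT3 GT_simps by blast
qed (auto simp: carrier_GT3 GT_simps ut_times one_ut ut_inj coords_C_def algebra_simps)

definition cent :: "'a::field ut_coords set \<Rightarrow> 'a ut_coords \<Rightarrow> 'a ut_coords set" where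
  "cent V h = {p \<in> V. ut_mult p h = ut_mult h p}"

lemma centralizer_ut: "centralizer (GT 3\<lparr>carrier := ut ` V\<rparr>) {ut h} = ut ` cent V h"
  by (auto simp: centralizer_def cent_def GT_simps ut_times ut_inj)

definition coord_iso :: "'a::field ut_coords set \<Rightarrow> 'a ut_coords set \<Rightarrow> bool" where
  "coord_iso U W \<longleftrightarrow> (\<exists>F. bij_betw F U W \<and>
     (\<forall>p\<in>U. \<forall>p'\<in>U. F (ut_mult p p') = ut_mult (F p) (F p')))"

lemma coord_isoI:
  assumes "\<And>p. p \<in> U \<Longrightarrow> F p \<in> W \<and> G (F p) = p"
    and "\<And>w. w \<in> W \<Longrightarrow> G w \<in> U \<and> F (G w) = w"
    and "\<And>p p'. p \<in> U \<Longrightarrow> p' \<in> U \<Longrightarrow> F (ut_mult p p') = ut_mult (F p) (F p')"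
  shows "coord_iso U W"
  unfolding coord_iso_def
proof (intro exI conjI)
  show "bij_betw F U W" by (rule bij_betw_byWitness[of _ G]) (use assms in auto)
qed (use assms in blast)

lemma coord_iso_refl: "coord_iso U U"
  by (rule coord_isoI[of _ "\<lambda>p. p" _ "\<lambda>p. p"]) auto

lemma coord_iso_imp_iso:
  assumes "coord_iso U W"
  shows "(GT 3)\<lparr>carrier := ut ` U\<rparr> \<cong> (GT 3)\<lparr>carrier := ut ` W\<rparr>"
proof -
  obtain F where F: "bij_betw F U W" "\<And>p p'. \<lbrakk>p \<in> U; p' \<in> U\<rbrakk> \<Longrightarrow> F (ut_mult p p') = ut_mult (F p) (F p')"
    using assms by (auto simp: coord_iso_def)
  have inv: "inv_into UNIV ut (ut p) = p" for p :: "'a ut_coords"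
    by (simp add: inv_f_f inj_def ut_inj)
  have "(\<lambda>A. ut (F (inv_into UNIV ut A))) \<in> iso ((GT 3)\<lparr>carrier := ut ` U\<rparr>) ((GT 3)\<lparr>carrier := ut ` W\<rparr>)"
    using F by (auto simp: iso_def hom_def bij_betw_def inj_on_def inv ut_times ut_inj GT_simps image_iff)
  then show ?thesis by (rule is_isoI)
qed

definition coords_A1 :: "'a::field ut_coords set" where
  "coords_A1 = {(x0, x1, x2, y0, y1, z0). x0 \<noteq> 0 \<and> z0 \<noteq> 0 \<and> y0 = x0 \<and> y1 = 0}"
definition coords_A2 :: "'a::field ut_coords set" where
  "coords_A2 = {(x0, x1, x2, y0, y1, z0). x0 \<noteq> 0 \<and> y0 \<noteq> 0 \<and> z0 = x0}"
definition coords_B1 :: "'a::field ut_coords set" where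
  "coords_B1 = {(x0, x1, x2, y0, y1, z0). x0 \<noteq> 0 \<and> y0 \<noteq> 0 \<and> z0 \<noteq> 0 \<and> x2 = 0 \<and> y1 = 0}"
definition coords_R1 :: "'a::field ut_coords set" where
  "coords_R1 = {(x0, x1, x2, y0, y1, z0). x0 \<noteq> 0 \<and> y0 = x0 \<and> z0 = x0 \<and> y1 = x1}"
definition coords_R2 :: "'a::field ut_coords set" where
  "coords_R2 = {(x0, x1, x2, y0, y1, z0). x0 \<noteq> 0 \<and> z0 \<noteq> 0 \<and> y0 = x0 \<and> x2 = 0 \<and> y1 = 0}"
definition coords_R3 :: "'a::field ut_coords set" where
  "coords_R3 = {(x0, x1, x2, y0, y1, z0). x0 \<noteq> 0 \<and> y0 \<noteq> 0 \<and> z0 \<noteq> 0 \<and> x1 = 0 \<and> x2 = 0 \<and> y1 = 0}"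

lemmas coords_defs = coords_C_def coords_A1_def coords_A2_def coords_B1_def coords_R1_def coords_R2_def coords_R3_def

lemma type_coords:
  "type_C = ut ` coords_C" "type_A1 = ut ` coords_A1" "type_A2 = ut ` coords_A2" "type_B1 = ut ` coords_B1"
  "type_R1 = ut ` coords_R1" "type_R2 = ut ` coords_R2" "type_R3 = ut ` coords_R3"
  unfolding type_C_def type_A1_def type_A2_def type_B1_def type_R1_def type_R2_def type_R3_def carrier_GT3
  by (auto simp: coords_defs ut_def image_iff) blast+

definition coords_list :: "'a::field ut_coords set list" where
  "coords_list = [coords_C, coords_A1, coords_A2, coords_B1, coords_R1, coords_R2, coords_R3]"

section \<open>Commuting triangular matrices\<close>

lemma ut_mult_commute_iff:
  "ut_mult (x0, x1, x2, y0, y1, z0) (a, b, c, d, e, f) = ut_mult (a, b, c, d, e, f) (x0, x1, x2, y0, y1, z0)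
   \<longleftrightarrow> b * (x0 - y0) = x1 * (a - d) \<and> e * (y0 - z0) = y1 * (d - f)
     \<and> c * (x0 - z0) + x1 * e - b * y1 = x2 * (a - f)"
  by (auto simp: algebra_simps)

lemma eq_iff_cancel:
  fixes u :: "'a::field"
  assumes "u \<noteq> 0" "L - R = u * (X - Y)"
  shows "L = R \<longleftrightarrow> X = Y"
  using assms by (metis mult_eq_0_iff right_minus_eq)

text \<open>In the next four lemmas the element that is centralized has diagonal \<open>(a, a, f)\<close>, \<open>(a, f, f)\<close>,
  \<open>(a, d, a)\<close> or \<open>(a, d, f)\<close> with different letters for different values; names such as \<open>aaf\<close> record
  this pattern. Its entries above the diagonal are written through parameters
  \<open>k\<close>, \<open>l\<close>, \<open>m\<close>, \<open>n\<close>: where the difference of two diagonal entries is nonzero it is split off as a factor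
  (the top right entry also needs a correction by a product of the others), so that solving for the commuting matrix \<open>(x0, x1, x2, y0, y1, z0)\<close> becomes cancellation
  and the solution is polynomial in the parameters.\<close>

lemma commute_iff_aaf:
  fixes a f :: "'a::field"
  assumes af: "a \<noteq> f"
  shows "ut_mult (x0, x1, x2, y0, y1, z0) (a, b, m * (a - f) + b * l, a, l * (a - f), f)
      = ut_mult (a, b, m * (a - f) + b * l, a, l * (a - f), f) (x0, x1, x2, y0, y1, z0)
   \<longleftrightarrow> (b = 0 \<or> y0 = x0) \<and> y1 = l * (y0 - z0) \<and> x2 = m * (x0 - z0) + l * x1"
proof -
  have nz: "f - a \<noteq> 0" using af by simp
  have 1: "b * (x0 - y0) = x1 * (a - a) \<longleftrightarrow> b = 0 \<or> y0 = x0" by auto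
  have 2: "l * (a - f) * (y0 - z0) = y1 * (a - f) \<longleftrightarrow> y1 = l * (y0 - z0)"
    by (rule eq_iff_cancel[OF nz]) (simp add: algebra_simps)
  have 3: "(m * (a - f) + b * l) * (x0 - z0) + x1 * (l * (a - f)) - b * y1 = x2 * (a - f)
    \<longleftrightarrow> x2 = m * (x0 - z0) + l * x1" if "b = 0 \<or> y0 = x0" "y1 = l * (y0 - z0)"
    by (rule eq_iff_cancel[OF nz]) (use that(1) in \<open>auto simp: that(2) algebra_simps\<close>)
  show ?thesis unfolding ut_mult_commute_iff using 1 2 3 by blast
qed

lemma commute_iff_aff:
  fixes a f :: "'a::field"
  assumes af: "a \<noteq> f"
  shows "ut_mult (x0, x1, x2, y0, y1, z0) (a, k * (a - f), m * (a - f) - k * e, f, e, f)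
      = ut_mult (a, k * (a - f), m * (a - f) - k * e, f, e, f) (x0, x1, x2, y0, y1, z0)
   \<longleftrightarrow> (e = 0 \<or> y0 = z0) \<and> x1 = k * (x0 - y0) \<and> x2 = m * (x0 - z0) - k * y1"
proof -
  have nz: "f - a \<noteq> 0" using af by simp
  have 1: "e * (y0 - z0) = y1 * (f - f) \<longleftrightarrow> e = 0 \<or> y0 = z0" by auto
  have 2: "k * (a - f) * (x0 - y0) = x1 * (a - f) \<longleftrightarrow> x1 = k * (x0 - y0)"
    by (rule eq_iff_cancel[OF nz]) (simp add: algebra_simps)
  have 3: "(m * (a - f) - k * e) * (x0 - z0) + x1 * e - k * (a - f) * y1 = x2 * (a - f)
    \<longleftrightarrow> x2 = m * (x0 - z0) - k * y1" if "e = 0 \<or> y0 = z0" "x1 = k * (x0 - y0)"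
    by (rule eq_iff_cancel[OF nz]) (use that(1) in \<open>auto simp: that(2) algebra_simps\<close>)
  show ?thesis unfolding ut_mult_commute_iff using 1 2 3 by blast
qed

text \<open>Here the parameter \<open>n\<close> is the entry in the top right corner after conjugating the two
  neighbouring entries away. Unless it vanishes, the first and last
  diagonal entries of a commuting matrix must agree.\<close>

lemma commute_iff_ada:
  fixes a d :: "'a::field"
  assumes ad: "a \<noteq> d"
  shows "ut_mult (x0, x1, x2, y0, y1, z0) (a, k * (a - d), n - k * l * (d - a), d, l * (d - a), a)
      = ut_mult (a, k * (a - d), n - k * l * (d - a), d, l * (d - a), a) (x0, x1, x2, y0, y1, z0)
   \<longleftrightarrow> x1 = k * (x0 - y0) \<and> y1 = l * (y0 - z0) \<and> (n = 0 \<or> x0 = z0)"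
proof -
  have nz: "d - a \<noteq> 0" "a - d \<noteq> 0" using ad by simp_all
  have 1: "k * (a - d) * (x0 - y0) = x1 * (a - d) \<longleftrightarrow> x1 = k * (x0 - y0)"
    by (rule eq_iff_cancel[OF nz(1)]) (simp add: algebra_simps)
  have 2: "l * (d - a) * (y0 - z0) = y1 * (d - a) \<longleftrightarrow> y1 = l * (y0 - z0)"
    by (rule eq_iff_cancel[OF nz(2)]) (simp add: algebra_simps)
  have 3: "(n - k * l * (d - a)) * (x0 - z0) + x1 * (l * (d - a)) - k * (a - d) * y1 = x2 * (a - a)
    \<longleftrightarrow> n = 0 \<or> x0 = z0" if "x1 = k * (x0 - y0)" "y1 = l * (y0 - z0)"
  proof -
    have "(n - k * l * (d - a)) * (x0 - z0) + x1 * (l * (d - a)) - k * (a - d) * y1 = n * (x0 - z0)"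
      unfolding that by (simp add: algebra_simps)
    then show ?thesis by simp
  qed
  show ?thesis unfolding ut_mult_commute_iff using 1 2 3 by blast
qed

lemma commute_iff_adf:
  fixes a d f :: "'a::field"
  assumes "a \<noteq> d" "d \<noteq> f" "a \<noteq> f"
  shows "ut_mult (x0, x1, x2, y0, y1, z0) (a, k * (a - d), m * (a - f) + k * l * (a - d), d, l * (d - f), f)
      = ut_mult (a, k * (a - d), m * (a - f) + k * l * (a - d), d, l * (d - f), f) (x0, x1, x2, y0, y1, z0)
   \<longleftrightarrow> x1 = k * (x0 - y0) \<and> y1 = l * (y0 - z0) \<and> x2 = m * (x0 - z0) + k * l * (x0 - y0)"
proof -
  have nz: "d - a \<noteq> 0" "f - d \<noteq> 0" "f - a \<noteq> 0" using assms by simp_all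
  have 1: "k * (a - d) * (x0 - y0) = x1 * (a - d) \<longleftrightarrow> x1 = k * (x0 - y0)"
    by (rule eq_iff_cancel[OF nz(1)]) (simp add: algebra_simps)
  have 2: "l * (d - f) * (y0 - z0) = y1 * (d - f) \<longleftrightarrow> y1 = l * (y0 - z0)"
    by (rule eq_iff_cancel[OF nz(2)]) (simp add: algebra_simps)
  have 3: "(m * (a - f) + k * l * (a - d)) * (x0 - z0) + x1 * (l * (d - f)) - k * (a - d) * y1 = x2 * (a - f)
    \<longleftrightarrow> x2 = m * (x0 - z0) + k * l * (x0 - y0)" if "x1 = k * (x0 - y0)" "y1 = l * (y0 - z0)"
    by (rule eq_iff_cancel[OF nz(3)]) (simp add: that algebra_simps)
  show ?thesis unfolding ut_mult_commute_iff using 1 2 3 by blast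
qed

section \<open>Identification of the centralizers\<close>

text \<open>When \<open>x2\<close> and \<open>y1\<close> are determined by the other coordinates, forgetting them is an isomorphism.\<close>

lemma coord_iso_aaf_B1:
  "coord_iso {(x0, x1, x2, y0, y1, z0). x0 \<noteq> 0 \<and> y0 \<noteq> 0 \<and> z0 \<noteq> 0
      \<and> y1 = l * (y0 - z0) \<and> x2 = m * (x0 - z0) + l * x1} coords_B1"
  by (rule coord_isoI[where F = "\<lambda>(x0, x1, x2, y0, y1, z0). (x0, x1, 0, y0, 0, z0)"
      and G = "\<lambda>(x0, x1, x2, y0, y1, z0). (x0, x1, m * (x0 - z0) + l * x1, y0, l * (y0 - z0), z0)"];
      auto simp: coords_B1_def; simp add: algebra_simps)

lemma coord_iso_aaf_R2:
  "coord_iso {(x0, x1, x2, y0, y1, z0). x0 \<noteq> 0 \<and> z0 \<noteq> 0 \<and> y0 = x0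
      \<and> y1 = l * (y0 - z0) \<and> x2 = m * (x0 - z0) + l * x1} coords_R2"
  by (rule coord_isoI[where F = "\<lambda>(x0, x1, x2, y0, y1, z0). (x0, x1, 0, y0, 0, z0)"
      and G = "\<lambda>(x0, x1, x2, y0, y1, z0). (x0, x1, m * (x0 - z0) + l * x1, y0, l * (y0 - z0), z0)"];
      auto simp: coords_R2_def; simp add: algebra_simps)

text \<open>The nontrivial block now occupies the last two rows; moving it to the first two places
  the remaining diagonal entry last.\<close>

lemma coord_iso_aff_B1:
  "coord_iso {(x0, x1, x2, y0, y1, z0). x0 \<noteq> 0 \<and> y0 \<noteq> 0 \<and> z0 \<noteq> 0
      \<and> x1 = k * (x0 - y0) \<and> x2 = m * (x0 - z0) - k * y1} coords_B1"
  by (rule coord_isoI[where F = "\<lambda>(x0, x1, x2, y0, y1, z0). (y0, y1, 0, z0, 0, x0)"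
      and G = "\<lambda>(y0, y1, _, z0, _, x0). (x0, k * (x0 - y0), m * (x0 - z0) - k * y1, y0, y1, z0)"];
      auto simp: coords_B1_def; simp add: algebra_simps)

lemma coord_iso_aff_R2:
  "coord_iso {(x0, x1, x2, y0, y1, z0). x0 \<noteq> 0 \<and> z0 \<noteq> 0 \<and> y0 = z0
      \<and> x1 = k * (x0 - y0) \<and> x2 = m * (x0 - z0) - k * y1} coords_R2"
  by (rule coord_isoI[where F = "\<lambda>(x0, x1, x2, y0, y1, z0). (y0, y1, 0, z0, 0, x0)"
      and G = "\<lambda>(y0, y1, _, z0, _, x0). (x0, k * (x0 - y0), m * (x0 - z0) - k * y1, y0, y1, z0)"];
      auto simp: coords_R2_def; simp add: algebra_simps)

text \<open>The block is formed by the outer two diagonal entries. The product contributes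
  \<open>x1 * y1'\<close> to \<open>x2\<close>, and passing to \<open>x2 + k * y1\<close> absorbs this contribution: what remains is the
  multiplication of a \<open>2\<close> by \<open>2\<close> triangular block.\<close>

lemma coord_iso_ada_B1:
  "coord_iso {(x0, x1, x2, y0, y1, z0). x0 \<noteq> 0 \<and> y0 \<noteq> 0 \<and> z0 \<noteq> 0
      \<and> x1 = k * (x0 - y0) \<and> y1 = l * (y0 - z0)} coords_B1"
  by (rule coord_isoI[where F = "\<lambda>(x0, x1, x2, y0, y1, z0). (x0, x2 + k * y1, 0, z0, 0, y0)"
      and G = "\<lambda>(x0, w, _, z0, _, y0). (x0, k * (x0 - y0), w - k * (l * (y0 - z0)), y0, l * (y0 - z0), z0)"];
      auto simp: coords_B1_def; simp add: algebra_simps)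

lemma coord_iso_ada_R2:
  "coord_iso {(x0, x1, x2, y0, y1, z0). x0 \<noteq> 0 \<and> y0 \<noteq> 0 \<and> z0 = x0
      \<and> x1 = k * (x0 - y0) \<and> y1 = l * (y0 - z0)} coords_R2"
  by (rule coord_isoI[where F = "\<lambda>(x0, x1, x2, y0, y1, z0). (x0, x2 + k * y1, 0, z0, 0, y0)"
      and G = "\<lambda>(x0, w, _, z0, _, y0). (x0, k * (x0 - y0), w - k * (l * (y0 - z0)), y0, l * (y0 - z0), z0)"];
      auto simp: coords_R2_def; simp add: algebra_simps)

lemma coord_iso_adf_R3:
  "coord_iso {(x0, x1, x2, y0, y1, z0). x0 \<noteq> 0 \<and> y0 \<noteq> 0 \<and> z0 \<noteq> 0
      \<and> x1 = k * (x0 - y0) \<and> y1 = l * (y0 - z0) \<and> x2 = m * (x0 - z0) + k * l * (x0 - y0)} coords_R3"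
  by (rule coord_isoI[where F = "\<lambda>(x0, x1, x2, y0, y1, z0). (x0, 0, 0, y0, 0, z0)"
      and G = "\<lambda>(x0, _, _, y0, _, z0). (x0, k * (x0 - y0), m * (x0 - z0) + k * l * (x0 - y0), y0, l * (y0 - z0), z0)"])
    (auto simp: coords_R3_def)

text \<open>Centralizers of two kinds of unipotent matrices (times scalars): in the first the entry at
  position \<open>(1, 2)\<close> is nonzero and the one at \<open>(2, 3)\<close> is zero, in the second it is the other way round.
  A shear of \<open>x2\<close> brings the first to the normal form \<open>coords_A1\<close>. The second is the mirror image
  of the first, where the additive parameter \<open>y1 / z0\<close> accompanies the last diagonal entry; it
  splits off as a direct factor in both groups, and so can be moved to the first entry.\<close>

lemma coord_iso_first_A1:
  "coord_iso {(x0, x1, x2, y0, y1, z0). x0 \<noteq> 0 \<and> z0 \<noteq> 0 \<and> y0 = x0 \<and> y1 = m * (x0 - z0)} coords_A1"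
  by (rule coord_isoI[where F = "\<lambda>(x0, x1, x2, y0, y1, z0). (x0, x1, x2 - m * x1, y0, 0, z0)"
      and G = "\<lambda>(x0, x1, w, y0, _, z0). (x0, x1, w + m * x1, y0, m * (x0 - z0), z0)"];
      auto simp: coords_A1_def; simp add: algebra_simps)

lemma coord_iso_second_A1:
  "coord_iso {(x0, x1, x2, y0, y1, z0). x0 \<noteq> 0 \<and> z0 \<noteq> 0 \<and> y0 = z0 \<and> x1 = m * (x0 - z0)} coords_A1"
  by (rule coord_isoI[where F = "\<lambda>(x0, x1, x2, y0, y1, z0). (x0, x0 * y1 / z0, x2 + m * y1, x0, 0, z0)"
      and G = "\<lambda>(x0, x1, w, _, _, z0). (x0, m * (x0 - z0), w - m * (x1 * z0 / x0), z0, x1 * z0 / x0, z0)"];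
      auto simp: coords_A1_def; simp add: field_simps)

text \<open>Write \<open>(x1, y1) = (t * b, t * e)\<close>. The groups for different directions \<open>(b, e)\<close> are commutative
  and differ in the term \<open>b * e * t * t'\<close> that the product contributes to \<open>x2\<close>. Such a symmetric
  bilinear term is changed to \<open>t * t'\<close>, as needed for \<open>coords_R1\<close>, by adding a multiple of
  \<open>t^2 / x0\<close> to \<open>x2\<close>; the multiple is \<open>(1 - b * e) / 2\<close>. This is where odd characteristic enters.
  The coefficients \<open>u\<close>, \<open>v\<close> serve to express \<open>t\<close> linearly in \<open>x1\<close>, \<open>y1\<close> without distinguishing whether
  \<open>b\<close> or \<open>e\<close> is nonzero.\<close>

lemma coord_iso_R1:
  fixes b e u v :: "'a::field"
  assumes uv: "u * b + v * e = 1" and two: "(2 :: 'a) \<noteq> 0"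
  shows "coord_iso {(x0, x1, x2, y0, y1, z0). x0 \<noteq> (0::'a) \<and> y0 = x0 \<and> z0 = x0 \<and> x1 * e = b * y1} coords_R1"
proof -
  define n where "n = (1 - b * e) / 2"
  have n: "1 = b * e + n + n" using two by (simp add: n_def field_simps)
  define s where "s x1 y1 = u * x1 + v * y1" for x1 y1 :: 'a
  have s: "s x1 y1 * b = x1" "s x1 y1 * e = y1" if "x1 * e = b * y1" for x1 y1
  proof -
    have "s x1 y1 * b = x1 * (u * b + v * e)" "s x1 y1 * e = y1 * (u * b + v * e)"
      using that by (simp_all add: s_def algebra_simps)
    then show "s x1 y1 * b = x1" "s x1 y1 * e = y1" by (simp_all add: uv)
  qed
  have s': "s (t * b) (t * e) = t" for t
  proof -
    have "s (t * b) (t * e) = t * (u * b + v * e)" by (simp add: s_def algebra_simps)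
    then show ?thesis by (simp add: uv)
  qed
  show ?thesis
  proof (rule coord_isoI[where F = "\<lambda>(x0, x1, x2, y0, y1, z0). (x0, s x1 y1, x2 + n * (s x1 y1)^2 / x0, x0, s x1 y1, x0)"
      and G = "\<lambda>(x0, t, w, _, _, _). (x0, t * b, w - n * t^2 / x0, x0, t * e, x0)"])
    fix p p' :: "'a ut_coords" assume p: "p \<in> {(x0, x1, x2, y0, y1, z0). x0 \<noteq> 0 \<and> y0 = x0 \<and> z0 = x0 \<and> x1 * e = b * y1}"
      "p' \<in> {(x0, x1, x2, y0, y1, z0). x0 \<noteq> 0 \<and> y0 = x0 \<and> z0 = x0 \<and> x1 * e = b * y1}"
    obtain x0 x1 x2 y1 where pq: "p = (x0, x1, x2, x0, y1, x0)" "x0 \<noteq> 0" "x1 * e = b * y1" using p by auto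
    obtain x0' x1' x2' y1' where pq': "p' = (x0', x1', x2', x0', y1', x0')" "x0' \<noteq> 0" "x1' * e = b * y1'" using p by auto
    define t where "t = s x1 y1"
    define t' where "t' = s x1' y1'"
    have st: "s (x0 * x1' + x1 * x0') (x0 * y1' + y1 * x0') = x0 * t' + t * x0'"
      by (simp add: s_def t_def t'_def algebra_simps)
    have x: "x1 * y1' = t * t' * (b * e)"
      using s[OF pq(3)] s[OF pq'(3)] by (metis t_def t'_def mult.assoc mult.commute)
    have "x1 * y1' + n * (x0 * t' + t * x0')^2 / (x0 * x0')
        = t * t' * (b * e + n + n) + x0 * (n * t'^2 / x0') + n * t^2 / x0 * x0'"
      unfolding x using pq(2) pq'(2) by (simp add: power2_eq_square field_simps)
    then have "x1 * y1' + n * (x0 * t' + t * x0')^2 / (x0 * x0')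
        = t * t' + x0 * (n * t'^2 / x0') + n * t^2 / x0 * x0'"
      by (simp add: n[symmetric])
    then show "(\<lambda>(x0, x1, x2, y0, y1, z0). (x0, s x1 y1, x2 + n * (s x1 y1)^2 / x0, x0, s x1 y1, x0)) (ut_mult p p')
      = ut_mult ((\<lambda>(x0, x1, x2, y0, y1, z0). (x0, s x1 y1, x2 + n * (s x1 y1)^2 / x0, x0, s x1 y1, x0)) p)
         ((\<lambda>(x0, x1, x2, y0, y1, z0). (x0, s x1 y1, x2 + n * (s x1 y1)^2 / x0, x0, s x1 y1, x0)) p')"
      unfolding pq(1) pq'(1) by (simp add: st t_def[symmetric] t'_def[symmetric]) (simp add: algebra_simps)
  qed (auto simp: coords_R1_def s s')
qed

lemma coord_iso_centI:
  assumes "coord_iso U W"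
    and "\<And>x0 x1 x2 y0 y1 z0. (x0, x1, x2, y0, y1, z0) \<in> V \<Longrightarrow>
      ut_mult (x0, x1, x2, y0, y1, z0) h = ut_mult h (x0, x1, x2, y0, y1, z0) \<longleftrightarrow> (x0, x1, x2, y0, y1, z0) \<in> U"
    and "U \<subseteq> V"
  shows "coord_iso (cent V h) W"
proof -
  have "cent V h = U" using assms(2,3) by (auto simp: cent_def simp del: ut_mult.simps)
  then show ?thesis using assms(1) by simp
qed

lemma cent_abelian:
  assumes "\<And>p p'. p \<in> V \<Longrightarrow> p' \<in> V \<Longrightarrow> ut_mult p p' = ut_mult p' p" and "h \<in> V"
  shows "coord_iso (cent V h) V"
proof -
  have "cent V h = V" using assms unfolding cent_def by blast
  then show ?thesis by (simp add: coord_iso_refl)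
qed

lemma cent_abelian_types:
  "h \<in> coords_R1 \<Longrightarrow> coord_iso (cent coords_R1 h) coords_R1"
  "h \<in> coords_R2 \<Longrightarrow> coord_iso (cent coords_R2 h) coords_R2"
  "h \<in> coords_R3 \<Longrightarrow> coord_iso (cent coords_R3 h) coords_R3"
  by (rule cent_abelian; auto simp: coords_defs algebra_simps)+

lemma cent_C_aaa:
  fixes a b c e :: "'a::field"
  shows "coord_iso (cent coords_C (a, 0, 0, a, 0, a)) coords_C"
    and "b \<noteq> 0 \<Longrightarrow> coord_iso (cent coords_C (a, b, c, a, 0, a)) coords_A1"
    and "e \<noteq> 0 \<Longrightarrow> coord_iso (cent coords_C (a, 0, c, a, e, a)) coords_A1"
    and "c \<noteq> 0 \<Longrightarrow> coord_iso (cent coords_C (a, 0, c, a, 0, a)) coords_A2"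
    and "b \<noteq> 0 \<Longrightarrow> e \<noteq> 0 \<Longrightarrow> (2 :: 'a) \<noteq> 0 \<Longrightarrow> coord_iso (cent coords_C (a, b, c, a, e, a)) coords_R1"
proof -
  show "coord_iso (cent coords_C (a, 0, 0, a, 0, a)) coords_C"
    by (rule coord_iso_centI[OF coord_iso_refl]) (auto simp: ut_mult_commute_iff coords_C_def simp del: ut_mult.simps)
next
  assume b: "b \<noteq> 0"
  show "coord_iso (cent coords_C (a, b, c, a, 0, a)) coords_A1"
    by (rule coord_iso_centI[OF coord_iso_first_A1[of "c / b"]])
      (use b in \<open>auto simp: ut_mult_commute_iff coords_C_def field_simps simp del: ut_mult.simps\<close>)
next
  assume e: "e \<noteq> 0"
  have "c * (x0 - z0) + x1 * e = 0 \<longleftrightarrow> x1 = - c / e * (x0 - z0)" for x0 x1 z0 :: 'a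
    by (rule eq_iff_cancel[OF e]) (use e in \<open>simp add: field_simps\<close>)
  then show "coord_iso (cent coords_C (a, 0, c, a, e, a)) coords_A1"
    by (intro coord_iso_centI[OF coord_iso_second_A1[of "- c / e"]])
      (use e in \<open>auto simp: ut_mult_commute_iff coords_C_def simp del: ut_mult.simps\<close>)
next
  assume "c \<noteq> 0"
  then show "coord_iso (cent coords_C (a, 0, c, a, 0, a)) coords_A2"
    by (intro coord_iso_centI[OF coord_iso_refl])
      (auto simp: ut_mult_commute_iff coords_C_def coords_A2_def simp del: ut_mult.simps)
next
  assume be: "b \<noteq> 0" "e \<noteq> 0" and two: "(2 :: 'a) \<noteq> 0"
  show "coord_iso (cent coords_C (a, b, c, a, e, a)) coords_R1"
    by (rule coord_iso_centI[OF coord_iso_R1[of "1 / b" b 0 e, OF _ two]])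
      (use be in \<open>auto simp: ut_mult_commute_iff coords_C_def simp del: ut_mult.simps\<close>)
qed

lemma cent_C_aaf:
  fixes a f :: "'a::field"
  assumes af: "a \<noteq> f"
  shows "b = 0 \<Longrightarrow> coord_iso (cent coords_C (a, b, m * (a - f) + b * l, a, l * (a - f), f)) coords_B1"
    and "b \<noteq> 0 \<Longrightarrow> coord_iso (cent coords_C (a, b, m * (a - f) + b * l, a, l * (a - f), f)) coords_R2"
proof -
  show "coord_iso (cent coords_C (a, b, m * (a - f) + b * l, a, l * (a - f), f)) coords_B1" if "b = 0"
    by (rule coord_iso_centI[OF coord_iso_aaf_B1[of l m]], unfold commute_iff_aaf[OF af])
      (use that in \<open>auto simp: coords_C_def\<close>)
  show "coord_iso (cent coords_C (a, b, m * (a - f) + b * l, a, l * (a - f), f)) coords_R2" if "b \<noteq> 0"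
    by (rule coord_iso_centI[OF coord_iso_aaf_R2[of l m]], unfold commute_iff_aaf[OF af])
      (use that in \<open>auto simp: coords_C_def\<close>)
qed

lemma cent_C_aff:
  fixes a f :: "'a::field"
  assumes af: "a \<noteq> f"
  shows "e = 0 \<Longrightarrow> coord_iso (cent coords_C (a, k * (a - f), m * (a - f) - k * e, f, e, f)) coords_B1"
    and "e \<noteq> 0 \<Longrightarrow> coord_iso (cent coords_C (a, k * (a - f), m * (a - f) - k * e, f, e, f)) coords_R2"
proof -
  show "coord_iso (cent coords_C (a, k * (a - f), m * (a - f) - k * e, f, e, f)) coords_B1" if "e = 0"
    by (rule coord_iso_centI[OF coord_iso_aff_B1[of k m]], unfold commute_iff_aff[OF af])
      (use that in \<open>auto simp: coords_C_def\<close>)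
  show "coord_iso (cent coords_C (a, k * (a - f), m * (a - f) - k * e, f, e, f)) coords_R2" if "e \<noteq> 0"
    by (rule coord_iso_centI[OF coord_iso_aff_R2[of k m]], unfold commute_iff_aff[OF af])
      (use that in \<open>auto simp: coords_C_def\<close>)
qed

lemma cent_C_ada:
  fixes a d :: "'a::field"
  assumes ad: "a \<noteq> d"
  shows "n = 0 \<Longrightarrow> coord_iso (cent coords_C (a, k * (a - d), n - k * l * (d - a), d, l * (d - a), a)) coords_B1"
    and "n \<noteq> 0 \<Longrightarrow> coord_iso (cent coords_C (a, k * (a - d), n - k * l * (d - a), d, l * (d - a), a)) coords_R2"
proof -
  show "coord_iso (cent coords_C (a, k * (a - d), n - k * l * (d - a), d, l * (d - a), a)) coords_B1" if "n = 0"
    by (rule coord_iso_centI[OF coord_iso_ada_B1[of k l]], unfold commute_iff_ada[OF ad])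
      (use that in \<open>auto simp: coords_C_def\<close>)
  show "coord_iso (cent coords_C (a, k * (a - d), n - k * l * (d - a), d, l * (d - a), a)) coords_R2" if "n \<noteq> 0"
    by (rule coord_iso_centI[OF coord_iso_ada_R2[of k l]], unfold commute_iff_ada[OF ad])
      (use that in \<open>auto simp: coords_C_def\<close>)
qed

lemma cent_C_adf:
  fixes a d f :: "'a::field"
  assumes "a \<noteq> d" "d \<noteq> f" "a \<noteq> f"
  shows "coord_iso (cent coords_C (a, k * (a - d), m * (a - f) + k * l * (a - d), d, l * (d - f), f)) coords_R3"
  by (rule coord_iso_centI[OF coord_iso_adf_R3[of k l m]], unfold commute_iff_adf[OF assms])
    (auto simp: coords_C_def)

lemma cent_A1:
  fixes a b c f l m :: "'a::field"
  shows "coord_iso (cent coords_A1 (a, b, 0, a, 0, a)) coords_A1"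
    and "c \<noteq> 0 \<Longrightarrow> (2 :: 'a) \<noteq> 0 \<Longrightarrow> coord_iso (cent coords_A1 (a, b, c, a, 0, a)) coords_R1"
    and "a \<noteq> f \<Longrightarrow> l = 0 \<Longrightarrow> coord_iso (cent coords_A1 (a, b, m * (a - f) + b * l, a, l * (a - f), f)) coords_R2"
proof -
  show "coord_iso (cent coords_A1 (a, b, 0, a, 0, a)) coords_A1"
    by (rule coord_iso_centI[OF coord_iso_refl]) (auto simp: ut_mult_commute_iff coords_A1_def simp del: ut_mult.simps)
  show "coord_iso (cent coords_A1 (a, b, c, a, 0, a)) coords_R1" if "c \<noteq> 0" "(2 :: 'a) \<noteq> 0"
    by (rule coord_iso_centI[OF coord_iso_R1[of 1 1 0 0, OF _ that(2)]])
      (use that in \<open>auto simp: ut_mult_commute_iff coords_A1_def simp del: ut_mult.simps\<close>)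
  show "coord_iso (cent coords_A1 (a, b, m * (a - f) + b * l, a, l * (a - f), f)) coords_R2" if "a \<noteq> f" "l = 0"
    by (rule coord_iso_centI[OF coord_iso_aaf_R2[of l m]], unfold commute_iff_aaf[OF that(1)])
      (use that(2) in \<open>auto simp: coords_A1_def\<close>)
qed

lemma cent_A2:
  fixes a b c d e k l n :: "'a::field"
  shows "coord_iso (cent coords_A2 (a, 0, c, a, 0, a)) coords_A2"
    and "b \<noteq> 0 \<or> e \<noteq> 0 \<Longrightarrow> (2 :: 'a) \<noteq> 0 \<Longrightarrow> coord_iso (cent coords_A2 (a, b, c, a, e, a)) coords_R1"
    and "a \<noteq> d \<Longrightarrow> coord_iso (cent coords_A2 (a, k * (a - d), n - k * l * (d - a), d, l * (d - a), a)) coords_R2"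
proof -
  show "coord_iso (cent coords_A2 (a, 0, c, a, 0, a)) coords_A2"
    by (rule coord_iso_centI[OF coord_iso_refl]) (auto simp: ut_mult_commute_iff coords_A2_def simp del: ut_mult.simps)
  show "coord_iso (cent coords_A2 (a, b, c, a, e, a)) coords_R1" if be: "b \<noteq> 0 \<or> e \<noteq> 0" and two: "(2 :: 'a) \<noteq> 0"
  proof -
    obtain u v where uv: "u * b + v * e = 1"
    proof (cases "b = 0")
      case True
      then show ?thesis using be that[of 0 "1 / e"] by simp
    next
      case False
      then show ?thesis using that[of "1 / b" 0] by simp
    qed
    show ?thesis
      by (rule coord_iso_centI[OF coord_iso_R1[OF uv two]])
        (use be in \<open>auto simp: ut_mult_commute_iff coords_A2_def simp del: ut_mult.simps\<close>)
  qed
  show "coord_iso (cent coords_A2 (a, k * (a - d), n - k * l * (d - a), d, l * (d - a), a)) coords_R2" if "a \<noteq> d"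
    by (rule coord_iso_centI[OF coord_iso_ada_R2[of k l]], unfold commute_iff_ada[OF that])
      (auto simp: coords_A2_def)
qed

lemma cent_B1:
  fixes a b d f k :: "'a::field"
  shows "coord_iso (cent coords_B1 (a, 0, 0, a, 0, f)) coords_B1"
    and "b \<noteq> 0 \<Longrightarrow> coord_iso (cent coords_B1 (a, b, 0, a, 0, f)) coords_R2"
    and "a \<noteq> d \<Longrightarrow> coord_iso (cent coords_B1 (a, k * (a - d), 0, d, 0, f)) coords_R3"
proof -
  show "coord_iso (cent coords_B1 (a, 0, 0, a, 0, f)) coords_B1"
    by (rule coord_iso_centI[OF coord_iso_refl]) (auto simp: ut_mult_commute_iff coords_B1_def simp del: ut_mult.simps)
  show "coord_iso (cent coords_B1 (a, b, 0, a, 0, f)) coords_R2" if "b \<noteq> 0"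
    by (rule coord_iso_centI[OF coord_iso_refl])
      (use that in \<open>auto simp: ut_mult_commute_iff coords_B1_def coords_R2_def simp del: ut_mult.simps\<close>)
  assume "a \<noteq> d"
  then have "d - a \<noteq> 0" by simp
  then have "k * (a - d) * (x0 - y0) = x1 * (a - d) \<longleftrightarrow> x1 = k * (x0 - y0)" for x0 x1 y0 :: 'a
    by (rule eq_iff_cancel) (simp add: algebra_simps)
  then show "coord_iso (cent coords_B1 (a, k * (a - d), 0, d, 0, f)) coords_R3"
    by (intro coord_iso_centI[OF coord_iso_adf_R3[of k 0 0]])
      (auto simp: ut_mult_commute_iff coords_B1_def simp del: ut_mult.simps)
qed

section \<open>The elements of each type\<close>

definition nonzero :: "'a::field set" where
  "nonzero = - {0}"
definition nonzero_pairs :: "('a::field \<times> 'a) set" where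
  "nonzero_pairs = {(a, d). a \<noteq> 0 \<and> d \<noteq> 0 \<and> a \<noteq> d}"
definition nonzero_triples :: "('a::field \<times> 'a \<times> 'a) set" where
  "nonzero_triples = {(a, d, f). a \<noteq> 0 \<and> d \<noteq> 0 \<and> f \<noteq> 0 \<and> a \<noteq> d \<and> d \<noteq> f \<and> a \<noteq> f}"

text \<open>The elements with a given pattern of diagonal entries, parametrised as in the lemmas on
  commuting matrices; the sets \<open>D\<close>, \<open>E\<close>, \<open>N\<close>, \<open>B\<close> restrict those parameters on which the type of the
  centralizer depends. Being injective images of products, these sets are easily counted.\<close>

definition elems_aaa :: "('a::field \<times> 'a \<times> 'a) set \<Rightarrow> 'a ut_coords set" where
  "elems_aaa D = (\<lambda>(a, b, c, e). (a, b, c, a, e, a)) ` (nonzero \<times> D)"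
definition elems_aaf :: "('a::field \<times> 'a \<times> 'a) set \<Rightarrow> 'a ut_coords set" where
  "elems_aaf D = (\<lambda>((a, f), b, l, m). (a, b, m * (a - f) + b * l, a, l * (a - f), f)) ` (nonzero_pairs \<times> D)"
definition elems_aff :: "'a::field set \<Rightarrow> 'a ut_coords set" where
  "elems_aff E = (\<lambda>((a, f), e, k, m). (a, k * (a - f), m * (a - f) - k * e, f, e, f)) ` (nonzero_pairs \<times> E \<times> UNIV)"
definition elems_ada :: "'a::field set \<Rightarrow> 'a ut_coords set" where
  "elems_ada N = (\<lambda>((a, d), n, k, l). (a, k * (a - d), n - k * l * (d - a), d, l * (d - a), a)) ` (nonzero_pairs \<times> N \<times> UNIV)"
definition elems_adf :: "'a::field ut_coords set" where
  "elems_adf = (\<lambda>((a, d, f), k, l, m). (a, k * (a - d), m * (a - f) + k * l * (a - d), d, l * (d - f), f)) ` (nonzero_triples \<times> UNIV)"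

definition elems_B1 :: "'a::field set \<Rightarrow> 'a ut_coords set" where
  "elems_B1 B = (\<lambda>(a, f, b). (a, b, 0, a, 0, f)) ` (nonzero \<times> nonzero \<times> B)"
definition elems_B1_R3 :: "'a::field ut_coords set" where
  "elems_B1_R3 = (\<lambda>((a, d), f, k). (a, k * (a - d), 0, d, 0, f)) ` (nonzero_pairs \<times> nonzero \<times> UNIV)"

text \<open>Row \<open>s\<close>, column \<open>t\<close> holds the elements of the \<open>t\<close>-th model group whose centralizer in it is
  of the \<open>s\<close>-th type.\<close>

definition branch_table :: "'a::field ut_coords set list list" where
  "branch_table =
    [[elems_aaa {(0, 0, 0)}, {}, {}, {}, {}, {}, {}],
     [elems_aaa (nonzero \<times> UNIV \<times> {0}) \<union> elems_aaa ({0} \<times> UNIV \<times> nonzero), elems_aaa (UNIV \<times> {0} \<times> {0}), {}, {}, {}, {}, {}],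
     [elems_aaa ({0} \<times> nonzero \<times> {0}), {}, elems_aaa ({0} \<times> UNIV \<times> {0}), {}, {}, {}, {}],
     [elems_aaf ({0} \<times> UNIV) \<union> elems_aff {0} \<union> elems_ada {0}, {}, {}, elems_B1 {0}, {}, {}, {}],
     [elems_aaa (nonzero \<times> UNIV \<times> nonzero), elems_aaa (UNIV \<times> nonzero \<times> {0}),
        elems_aaa (nonzero \<times> UNIV) \<union> elems_aaa ({0} \<times> UNIV \<times> nonzero), {}, coords_R1, {}, {}],
     [elems_aaf (nonzero \<times> UNIV) \<union> elems_aff nonzero \<union> elems_ada nonzero, elems_aaf (UNIV \<times> {0} \<times> UNIV),
        elems_ada UNIV, elems_B1 nonzero, {}, coords_R2, {}],
     [elems_adf, {}, {}, elems_B1_R3, {}, {}, coords_R3]]"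

lemmas elems_defs = elems_aaa_def elems_aaf_def elems_aff_def elems_ada_def elems_adf_def
  elems_B1_def elems_B1_R3_def

lemma less7: "s < 7 \<longleftrightarrow> s = 0 \<or> s = 1 \<or> s = 2 \<or> s = 3 \<or> s = 4 \<or> s = 5 \<or> s = (6::nat)"
  by auto

lemma UN_less7: "(\<Union>s<7. F s) = F 0 \<union> F 1 \<union> F 2 \<union> F 3 \<union> F 4 \<union> F 5 \<union> F (6::nat)"
  by (auto simp: less7)

lemma cent_branch_table:
  fixes h :: "'a::field ut_coords"
  assumes "(2 :: 'a) \<noteq> 0" "s < 7" "t < 7" "h \<in> branch_table ! s ! t"
  shows "coord_iso (cent (coords_list ! t) h) (coords_list ! s)"
  using assms(2-4)
  by (auto simp: less7 branch_table_def coords_list_def elems_defs nonzero_def nonzero_pairs_def nonzero_triples_def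
      intro!: cent_abelian_types cent_C_aaa cent_C_aaf cent_C_aff cent_C_ada cent_C_adf cent_A1 cent_A2 cent_B1 assms(1))

text \<open>Solving for the parameters shows that the parametrised families miss no element with the
  given pattern of diagonal entries.\<close>

lemma elems_memI:
  fixes a b c d e f :: "'a::field"
  shows "a \<noteq> 0 \<Longrightarrow> (b, c, e) \<in> D \<Longrightarrow> (a, b, c, a, e, a) \<in> elems_aaa D"
    and "a \<noteq> 0 \<Longrightarrow> f \<noteq> 0 \<Longrightarrow> a \<noteq> f \<Longrightarrow> (b, e / (a - f), (c - b * (e / (a - f))) / (a - f)) \<in> D' \<Longrightarrow> (a, b, c, a, e, f) \<in> elems_aaf D'"
    and "a \<noteq> 0 \<Longrightarrow> f \<noteq> 0 \<Longrightarrow> a \<noteq> f \<Longrightarrow> e \<in> E \<Longrightarrow> (a, b, c, f, e, f) \<in> elems_aff E"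
    and "a \<noteq> 0 \<Longrightarrow> d \<noteq> 0 \<Longrightarrow> a \<noteq> d \<Longrightarrow> c + b / (a - d) * e \<in> N \<Longrightarrow> (a, b, c, d, e, a) \<in> elems_ada N"
    and "a \<noteq> 0 \<Longrightarrow> d \<noteq> 0 \<Longrightarrow> f \<noteq> 0 \<Longrightarrow> a \<noteq> d \<Longrightarrow> d \<noteq> f \<Longrightarrow> a \<noteq> f \<Longrightarrow> (a, b, c, d, e, f) \<in> elems_adf"
    and "a \<noteq> 0 \<Longrightarrow> f \<noteq> 0 \<Longrightarrow> b \<in> B \<Longrightarrow> (a, b, 0, a, 0, f) \<in> elems_B1 B"
    and "a \<noteq> 0 \<Longrightarrow> d \<noteq> 0 \<Longrightarrow> f \<noteq> 0 \<Longrightarrow> a \<noteq> d \<Longrightarrow> (a, b, 0, d, 0, f) \<in> elems_B1_R3"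
proof -
  show "(a, b, c, a, e, a) \<in> elems_aaa D" if "a \<noteq> 0" "(b, c, e) \<in> D"
    using that unfolding elems_aaa_def nonzero_def by (intro image_eqI[of _ _ "(a, b, c, e)"]) auto
  show "(a, b, c, a, e, f) \<in> elems_aaf D'"
    if "a \<noteq> 0" "f \<noteq> 0" "a \<noteq> f" "(b, e / (a - f), (c - b * (e / (a - f))) / (a - f)) \<in> D'"
    using that unfolding elems_aaf_def nonzero_pairs_def
    by (intro image_eqI[of _ _ "((a, f), b, e / (a - f), (c - b * (e / (a - f))) / (a - f))"]) auto
  show "(a, b, c, f, e, f) \<in> elems_aff E" if "a \<noteq> 0" "f \<noteq> 0" "a \<noteq> f" "e \<in> E"
    using that unfolding elems_aff_def nonzero_pairs_def
    by (intro image_eqI[of _ _ "((a, f), e, b / (a - f), (c + b / (a - f) * e) / (a - f))"]) auto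
  show "(a, b, c, d, e, a) \<in> elems_ada N" if "a \<noteq> 0" "d \<noteq> 0" "a \<noteq> d" "c + b / (a - d) * e \<in> N"
    using that unfolding elems_ada_def nonzero_pairs_def
    by (intro image_eqI[of _ _ "((a, d), c + b / (a - d) * e, b / (a - d), e / (d - a))"]) auto
  show "(a, b, c, d, e, f) \<in> elems_adf" if "a \<noteq> 0" "d \<noteq> 0" "f \<noteq> 0" "a \<noteq> d" "d \<noteq> f" "a \<noteq> f"
    using that unfolding elems_adf_def nonzero_triples_def
    by (intro image_eqI[of _ _ "((a, d, f), b / (a - d), e / (d - f), (c - b / (a - d) * (e / (d - f)) * (a - d)) / (a - f))"]) auto
  show "(a, b, 0, a, 0, f) \<in> elems_B1 B" if "a \<noteq> 0" "f \<noteq> 0" "b \<in> B"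
    using that unfolding elems_B1_def nonzero_def by (intro image_eqI[of _ _ "(a, f, b)"]) auto
  show "(a, b, 0, d, 0, f) \<in> elems_B1_R3" if "a \<noteq> 0" "d \<noteq> 0" "f \<noteq> 0" "a \<noteq> d"
    using that unfolding elems_B1_R3_def nonzero_def nonzero_pairs_def
    by (intro image_eqI[of _ _ "((a, d), f, b / (a - d))"]) auto
qed

lemma branch_table_covers_C: "(coords_C :: 'a::field ut_coords set) = (\<Union>s<7. branch_table ! s ! 0)"
proof (rule antisym)
  show "(\<Union>s<7. branch_table ! s ! 0) \<subseteq> (coords_C :: 'a ut_coords set)"
    by (auto simp: UN_less7 branch_table_def coords_C_def elems_defs nonzero_def nonzero_pairs_def nonzero_triples_def)
  show "(coords_C :: 'a ut_coords set) \<subseteq> (\<Union>s<7. branch_table ! s ! 0)"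
  proof
    fix h :: "'a ut_coords" assume "h \<in> coords_C"
    then obtain a b c d e f where h: "h = (a, b, c, d, e, f)" and nz: "a \<noteq> 0" "d \<noteq> 0" "f \<noteq> 0"
      by (auto simp: coords_C_def)
    consider "a = d" "d = f" | "a = d" "d \<noteq> f" | "d = f" "a \<noteq> d" | "a = f" "a \<noteq> d"
      | "a \<noteq> d" "d \<noteq> f" "a \<noteq> f" by blast
    then show "h \<in> (\<Union>s<7. branch_table ! s ! 0)"
      by cases (use nz in \<open>auto simp: h UN_less7 branch_table_def nonzero_def intro: elems_memI\<close>)
  qed
qed

lemma branch_table_covers:
  assumes "t < 7"
  shows "(coords_list ! t :: 'a::field ut_coords set) = (\<Union>s<7. branch_table ! s ! t)"
proof -
  have "(coords_A1 :: 'a ut_coords set) = (\<Union>s<7. branch_table ! s ! 1)"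
  proof (rule antisym)
    show "(\<Union>s<7. branch_table ! s ! 1) \<subseteq> (coords_A1 :: 'a ut_coords set)"
      by (auto simp: UN_less7 branch_table_def coords_A1_def elems_defs nonzero_def nonzero_pairs_def)
    show "(coords_A1 :: 'a ut_coords set) \<subseteq> (\<Union>s<7. branch_table ! s ! 1)"
    proof
      fix h :: "'a ut_coords" assume "h \<in> coords_A1"
      then obtain a b c f where h: "h = (a, b, c, a, 0, f)" and nz: "a \<noteq> 0" "f \<noteq> 0"
        by (auto simp: coords_A1_def)
      then show "h \<in> (\<Union>s<7. branch_table ! s ! 1)"
        by (cases "a = f") (auto simp: UN_less7 branch_table_def nonzero_def intro: elems_memI)
    qed
  qed
  moreover have "(coords_A2 :: 'a ut_coords set) = (\<Union>s<7. branch_table ! s ! 2)"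
  proof (rule antisym)
    show "(\<Union>s<7. branch_table ! s ! 2) \<subseteq> (coords_A2 :: 'a ut_coords set)"
      by (auto simp: UN_less7 branch_table_def coords_A2_def elems_defs nonzero_def nonzero_pairs_def)
    show "(coords_A2 :: 'a ut_coords set) \<subseteq> (\<Union>s<7. branch_table ! s ! 2)"
    proof
      fix h :: "'a ut_coords" assume "h \<in> coords_A2"
      then obtain a b c d e where h: "h = (a, b, c, d, e, a)" and nz: "a \<noteq> 0" "d \<noteq> 0"
        by (auto simp: coords_A2_def)
      then show "h \<in> (\<Union>s<7. branch_table ! s ! 2)"
        by (cases "a = d") (auto simp: UN_less7 branch_table_def nonzero_def intro: elems_memI)
    qed
  qed
  moreover have "(coords_B1 :: 'a ut_coords set) = (\<Union>s<7. branch_table ! s ! 3)"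
  proof (rule antisym)
    show "(\<Union>s<7. branch_table ! s ! 3) \<subseteq> (coords_B1 :: 'a ut_coords set)"
      by (auto simp: UN_less7 branch_table_def coords_B1_def elems_defs nonzero_def nonzero_pairs_def)
    show "(coords_B1 :: 'a ut_coords set) \<subseteq> (\<Union>s<7. branch_table ! s ! 3)"
    proof
      fix h :: "'a ut_coords" assume "h \<in> coords_B1"
      then obtain a b d f where h: "h = (a, b, 0, d, 0, f)" and nz: "a \<noteq> 0" "d \<noteq> 0" "f \<noteq> 0"
        by (auto simp: coords_B1_def)
      then show "h \<in> (\<Union>s<7. branch_table ! s ! 3)"
        by (cases "a = d") (auto simp: UN_less7 branch_table_def nonzero_def intro: elems_memI)
    qed
  qed
  moreover have "coords_R1 = (\<Union>s<7. branch_table ! s ! 4)" "coords_R2 = (\<Union>s<7. branch_table ! s ! 5)"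
    "coords_R3 = (\<Union>s<7. branch_table ! s ! 6)"
    by (simp_all add: UN_less7 branch_table_def)
  ultimately show ?thesis
    using assms branch_table_covers_C by (auto simp: less7 coords_list_def)
qed

section \<open>Counting\<close>

lemma card_Compl_int:
  fixes A :: "'a::finite set"
  shows "int (card (- A)) = int CARD('a) - int (card A)"
  by (simp add: Compl_eq_Diff_UNIV card_Diff_subset of_nat_diff card_mono)

lemma card_nonzero: "int (card (nonzero :: 'a::{field,finite} set)) = int CARD('a) - 1"
  by (simp add: nonzero_def card_Compl_int)

lemma card_nonzero_pairs:
  "int (card (nonzero_pairs :: ('a::{field,finite} \<times> 'a) set)) = (int CARD('a) - 1) * (int CARD('a) - 2)"
proof -
  have "nonzero_pairs = (SIGMA a:(nonzero :: 'a set). - {0, a})"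
    by (auto simp: nonzero_pairs_def nonzero_def)
  then have "card (nonzero_pairs :: ('a \<times> 'a) set) = (\<Sum>a\<in>(nonzero :: 'a set). card (- {0, a}))"
    using card_SigmaI[of "nonzero :: 'a set" "\<lambda>a. - {0, a}"] by simp
  then have "int (card (nonzero_pairs :: ('a \<times> 'a) set)) = (\<Sum>a\<in>(nonzero :: 'a set). int (card (- {0, a})))"
    by simp
  also have "\<dots> = (\<Sum>a\<in>(nonzero :: 'a set). int CARD('a) - 2)"
    by (rule sum.cong) (auto simp: card_Compl_int nonzero_def)
  finally show ?thesis by (simp add: card_nonzero)
qed

lemma card_nonzero_triples:
  "int (card (nonzero_triples :: ('a::{field,finite} \<times> 'a \<times> 'a) set))
    = (int CARD('a) - 1) * (int CARD('a) - 2) * (int CARD('a) - 3)"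
proof -
  let ?g = "\<lambda>((a, d), f). (a, d, f) :: 'a \<times> 'a \<times> 'a"
  let ?D = "SIGMA p:(nonzero_pairs :: ('a \<times> 'a) set). - {0, fst p, snd p}"
  have "nonzero_triples = ?g ` ?D"
    by (force simp: nonzero_triples_def nonzero_pairs_def image_iff)
  then have "card (nonzero_triples :: ('a \<times> 'a \<times> 'a) set) = card (?g ` ?D)" by (rule arg_cong)
  also have "\<dots> = card ?D"
    by (rule card_image) (auto simp: inj_on_def)
  also have "\<dots> = (\<Sum>p\<in>(nonzero_pairs :: ('a \<times> 'a) set). card (- {0, fst p, snd p}))"
    by (rule card_SigmaI) auto
  finally have "card (nonzero_triples :: ('a \<times> 'a \<times> 'a) set)
      = (\<Sum>p\<in>(nonzero_pairs :: ('a \<times> 'a) set). card (- {0, fst p, snd p}))" .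
  then have "int (card (nonzero_triples :: ('a \<times> 'a \<times> 'a) set))
      = (\<Sum>p\<in>(nonzero_pairs :: ('a \<times> 'a) set). int (card (- {0, fst p, snd p})))"
    by simp
  also have "\<dots> = (\<Sum>p\<in>(nonzero_pairs :: ('a \<times> 'a) set). int CARD('a) - 3)"
    by (rule sum.cong) (auto simp: card_Compl_int nonzero_pairs_def)
  finally show ?thesis by (simp add: card_nonzero_pairs)
qed

lemma card_elems:
  fixes D :: "('a::{field,finite} \<times> 'a \<times> 'a) set" and E :: "'a set"
  shows "card (elems_aaa D) = card (nonzero :: 'a set) * card D"
    and "card (elems_aaf D) = card (nonzero_pairs :: ('a \<times> 'a) set) * card D"
    and "card (elems_aff E) = card (nonzero_pairs :: ('a \<times> 'a) set) * (card E * CARD('a) ^ 2)"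
    and "card (elems_ada E) = card (nonzero_pairs :: ('a \<times> 'a) set) * (card E * CARD('a) ^ 2)"
    and "card (elems_adf :: 'a ut_coords set) = card (nonzero_triples :: ('a \<times> 'a \<times> 'a) set) * CARD('a) ^ 3"
    and "card (elems_B1 E) = card (nonzero :: 'a set) * (card (nonzero :: 'a set) * card E)"
    and "card (elems_B1_R3 :: 'a ut_coords set) = card (nonzero_pairs :: ('a \<times> 'a) set) * (card (nonzero :: 'a set) * CARD('a))"
  unfolding elems_defs
  by (subst card_image; auto simp: inj_on_def nonzero_pairs_def nonzero_triples_def card_cartesian_product
      power2_eq_square power3_eq_cube)+

lemma card_coords:
  "card (coords_C :: 'a::{field,finite} ut_coords set) = card (nonzero :: 'a set) ^ 3 * CARD('a) ^ 3"
  "card (coords_A1 :: 'a ut_coords set) = card (nonzero :: 'a set) ^ 2 * CARD('a) ^ 2"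
  "card (coords_A2 :: 'a ut_coords set) = card (nonzero :: 'a set) ^ 2 * CARD('a) ^ 3"
  "card (coords_B1 :: 'a ut_coords set) = card (nonzero :: 'a set) ^ 3 * CARD('a)"
  "card (coords_R1 :: 'a ut_coords set) = card (nonzero :: 'a set) * CARD('a) ^ 2"
  "card (coords_R2 :: 'a ut_coords set) = card (nonzero :: 'a set) ^ 2 * CARD('a)"
  "card (coords_R3 :: 'a ut_coords set) = card (nonzero :: 'a set) ^ 3"
proof -
  let ?N = "nonzero :: 'a set" and ?U = "UNIV :: 'a set"
  have eq: "coords_C = (\<lambda>(x0, y0, z0, x1, x2, y1). (x0, x1, x2, y0, y1, z0)) ` (?N \<times> ?N \<times> ?N \<times> ?U \<times> ?U \<times> ?U)"
    "coords_A1 = (\<lambda>(x0, z0, x1, x2). (x0, x1, x2, x0, 0, z0)) ` (?N \<times> ?N \<times> ?U \<times> ?U)"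
    "coords_A2 = (\<lambda>(x0, y0, x1, x2, y1). (x0, x1, x2, y0, y1, x0)) ` (?N \<times> ?N \<times> ?U \<times> ?U \<times> ?U)"
    "coords_B1 = (\<lambda>(x0, y0, z0, x1). (x0, x1, 0, y0, 0, z0)) ` (?N \<times> ?N \<times> ?N \<times> ?U)"
    "coords_R1 = (\<lambda>(x0, x1, x2). (x0, x1, x2, x0, x1, x0)) ` (?N \<times> ?U \<times> ?U)"
    "coords_R2 = (\<lambda>(x0, z0, x1). (x0, x1, 0, x0, 0, z0)) ` (?N \<times> ?N \<times> ?U)"
    "coords_R3 = (\<lambda>(x0, y0, z0). (x0, 0, 0, y0, 0, z0)) ` (?N \<times> ?N \<times> ?N)"
    by (auto simp: coords_defs nonzero_def image_iff)
  show "card (coords_C :: 'a ut_coords set) = card ?N ^ 3 * CARD('a) ^ 3"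
    "card (coords_A1 :: 'a ut_coords set) = card ?N ^ 2 * CARD('a) ^ 2"
    "card (coords_A2 :: 'a ut_coords set) = card ?N ^ 2 * CARD('a) ^ 3"
    "card (coords_B1 :: 'a ut_coords set) = card ?N ^ 3 * CARD('a)"
    "card (coords_R1 :: 'a ut_coords set) = card ?N * CARD('a) ^ 2"
    "card (coords_R2 :: 'a ut_coords set) = card ?N ^ 2 * CARD('a)"
    "card (coords_R3 :: 'a ut_coords set) = card ?N ^ 3"
    unfolding eq
    by (subst card_image; auto simp: inj_on_def card_cartesian_product power2_eq_square power3_eq_cube)+
qed

lemma branch_table_count:
  assumes "s < 7" "t < 7"
  shows "int (card (branch_table ! s ! t :: 'a::{field,finite} ut_coords set)) * int (card (coords_list ! s :: 'a ut_coords set))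
    = (let q = int CARD('a) in
        [[q-1,               0,             0,             0,             0,         0,         0      ],
         [2*(q-1),           q*(q-1),       0,             0,             0,         0,         0      ],
         [q-1,               0,             q*(q-1),       0,             0,         0,         0      ],
         [3*(q-1)*(q-2),     0,             0,             (q-1)^2,       0,         0,         0      ],
         [q-1,               q*(q-1),       q^2-1,         0,             (q-1)*q^2, 0,         0      ],
         [3*(q-1)*(q-2),     q*(q-1)*(q-2), q*(q-1)*(q-2), (q-1)^2,       0,         (q-1)^2*q, 0      ],
         [(q-1)*(q-2)*(q-3), 0,             0,             (q-1)^2*(q-2), 0,         0,         (q-1)^3]] ! s ! t)
      * int (card (coords_list ! t :: 'a ut_coords set))"
proof -
  have disj: "elems_aaa (nonzero \<times> UNIV \<times> {0}) \<inter> elems_aaa ({0} \<times> UNIV \<times> nonzero) = ({} :: 'a ut_coords set)"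
    "elems_aaa (nonzero \<times> UNIV) \<inter> elems_aaa ({0} \<times> UNIV \<times> nonzero) = ({} :: 'a ut_coords set)"
    by (auto simp: elems_aaa_def nonzero_def)
  have disj': "elems_aaf D \<inter> elems_aff E = {}" "(elems_aaf D \<union> elems_aff E) \<inter> elems_ada E = {}"
    for D :: "('a \<times> 'a \<times> 'a) set" and E :: "'a set"
    by (auto simp: elems_defs nonzero_pairs_def)
  have un: "card (elems_aaa (nonzero \<times> UNIV \<times> {0}) \<union> elems_aaa ({0} \<times> UNIV \<times> nonzero) :: 'a ut_coords set)
      = 2 * (card (nonzero :: 'a set) * (card (nonzero :: 'a set) * CARD('a)))"
    "card (elems_aaa (nonzero \<times> UNIV) \<union> elems_aaa ({0} \<times> UNIV \<times> nonzero) :: 'a ut_coords set)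
      = card (nonzero :: 'a set) * (card (nonzero :: 'a set) * (CARD('a) * (CARD('a) + 1)))"
    "card (elems_aaf (E \<times> UNIV) \<union> elems_aff E \<union> elems_ada E) = 3 * (card (nonzero_pairs :: ('a \<times> 'a) set) * (card E * CARD('a) ^ 2))"
    for E :: "'a set"
    by (simp_all add: card_Un_disjoint disj disj' card_elems card_cartesian_product power2_eq_square algebra_simps)
  \<comment> \<open>Successor form lets list indexing be evaluated before any arithmetic.\<close>
  have s: "s \<in> {0, Suc 0, Suc (Suc 0), Suc (Suc (Suc 0)), Suc (Suc (Suc (Suc 0))),
      Suc (Suc (Suc (Suc (Suc 0)))), Suc (Suc (Suc (Suc (Suc (Suc 0)))))}" if "s < 7" for s :: nat
    using that by auto
  note cards = un card_elems card_coords card_cartesian_product card_nonzero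
    card_nonzero_pairs card_nonzero_triples
  \<comment> \<open>With names for the linear factors all entries become monomials, and comparing them
    needs only commutativity.\<close>
  define q where "q = int CARD('a)"
  define r where "r = q - 1"
  define u where "u = q - 2"
  define v where "v = q - 3"
  define w where "w = q + 1"
  have w: "1 + q = w" "q^2 - 1 = r * w" by (simp_all add: r_def w_def power2_eq_square algebra_simps)
  show ?thesis
    using s[OF assms(1)] s[OF assms(2)] unfolding branch_table_def coords_list_def Let_def insert_iff empty_iff
    by (elim disjE FalseE; simp only: nth_Cons_0 nth_Cons_Suc card.empty of_nat_0 mult_zero_left;
        simp only: cards of_nat_mult of_nat_power of_nat_add of_nat_1 of_nat_numeral
          q_def[symmetric] r_def[symmetric] u_def[symmetric] v_def[symmetric] w w_def[symmetric];
        simp add: power2_eq_square power3_eq_cube mult_ac)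
qed

text \<open>With \<open>q = r + 1\<close> and \<open>r \<ge> 2\<close> the orders form the strict chain
  \<open>r^3 < r^2 q < r q^2 < r^3 q < r^2 q^2 < r^2 q^3 < r^3 q^3\<close>; the third step amounts to \<open>q < r^2\<close>,
  the others to \<open>r < q\<close>, \<open>1 < q\<close> or \<open>1 < r\<close>.\<close>

lemma distinct_card_coords:
  assumes "CARD('a::{field,finite}) \<ge> 3"
  shows "distinct (map card (coords_list :: 'a ut_coords set list))"
proof -
  define r where "r = card (nonzero :: 'a set)"
  have q: "CARD('a) = r + 1" using card_nonzero[where 'a = 'a] by (simp add: r_def)
  have r: "r \<ge> 2" using assms q by simp
  have "r * r^2 < (r + 1) * r^2" "r * (r * (r + 1)) < (r + 1) * (r * (r + 1))"
    "(r + 1) * (r * (r + 1)) < (r * r) * (r * (r + 1))"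
    "r * (r^2 * (r + 1)) < (r + 1) * (r^2 * (r + 1))"
    "1 * (r^2 * (r + 1)^2) < (r + 1) * (r^2 * (r + 1)^2)"
    "1 * (r^2 * (r + 1)^3) < r * (r^2 * (r + 1)^3)"
  proof -
    have "2 * r \<le> r * r" using r by simp
    then have "r + 1 < r * r" using r by linarith
    then show "(r + 1) * (r * (r + 1)) < (r * r) * (r * (r + 1))"
      using r by (intro mult_strict_right_mono) auto
  qed (use r in \<open>auto intro!: mult_strict_right_mono simp del: mult_Suc mult_Suc_right\<close>)
  then have "r^3 < r^2 * (r + 1)" "r^2 * (r + 1) < r * (r + 1)^2" "r * (r + 1)^2 < r^3 * (r + 1)"
    "r^3 * (r + 1) < r^2 * (r + 1)^2" "r^2 * (r + 1)^2 < r^2 * (r + 1)^3" "r^2 * (r + 1)^3 < r^3 * (r + 1)^3"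
    by (simp_all only: power2_eq_square power3_eq_cube mult.assoc mult.commute mult.left_commute mult_1)
  moreover have "distinct [x7, x5, x6, x4, x3, x2, x1]"
    if "x1 < x2" "x2 < x3" "x3 < x4" "x4 < x5" "x5 < x6" "x6 < x7" for x1 x2 x3 x4 x5 x6 x7 :: nat
    using that by simp
  ultimately have "distinct [r^3 * (r + 1)^3, r^2 * (r + 1)^2, r^2 * (r + 1)^3, r^3 * (r + 1), r * (r + 1)^2, r^2 * (r + 1), r^3]"
    by blast
  then show ?thesis
    by (simp only: coords_list_def list.map card_coords r_def[symmetric] q)
qed

section \<open>The branching matrix\<close>

lemma char_ne_2:
  assumes "odd CARD('a::{field,finite})"
  shows "(2 :: 'a) \<noteq> 0"
proof
  assume two: "(2 :: 'a) = 0"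
  \<comment> \<open>Translation by \<open>1\<close> permutes the field, so the sum of all elements absorbs \<open>CARD('a)\<close> ones.\<close>
  have "(\<Sum>x\<in>UNIV. x + 1 :: 'a) = (\<Sum>x\<in>UNIV. x)"
    by (rule sum.reindex_bij_witness[of _ "\<lambda>x. x - 1" "\<lambda>x. x + 1"]) auto
  then have "of_nat CARD('a) = (0 :: 'a)" by (simp add: sum.distrib)
  moreover obtain k where "CARD('a) = 2 * k + 1" using assms by (rule oddE)
  ultimately show False using two by simp
qed

theorem theorem3p1:
  fixes q :: int
  assumes "q = int CARD('a::{field,finite})" and "odd q"
  shows "is_branching_matrix (GT 3 :: 'a mat monoid)
           [type_C, type_A1, type_A2, type_B1, type_R1, type_R2, type_R3]
           (mat_of_rows_list 7
             [[q-1,               0,             0,             0,             0,         0,         0      ],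
              [2*(q-1),           q*(q-1),       0,             0,             0,         0,         0      ],
              [q-1,               0,             q*(q-1),       0,             0,         0,         0      ],
              [3*(q-1)*(q-2),     0,             0,             (q-1)^2,       0,         0,         0      ],
              [q-1,               q*(q-1),       q^2-1,         0,             (q-1)*q^2, 0,         0      ],
              [3*(q-1)*(q-2),     q*(q-1)*(q-2), q*(q-1)*(q-2), (q-1)^2,       0,         (q-1)^2*q, 0      ],
              [(q-1)*(q-2)*(q-3), 0,             0,             (q-1)^2*(q-2), 0,         0,         (q-1)^3]])
    \<and> (\<forall>gs. commuting_tuple (GT 3 :: 'a mat monoid) gs \<longrightarrow>
           (\<exists>H \<in> {type_C, type_A1, type_A2, type_B1, type_R1, type_R2, type_R3}.
              has_type (GT 3) gs H))"
  (is "is_branching_matrix ?G ?Ts (mat_of_rows_list 7 ?rows) \<and> _")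
proof -
  have odd: "odd CARD('a)" using assms by simp
  have two: "(2 :: 'a) \<noteq> 0" using odd by (rule char_ne_2)
  have "card {0, 1 :: 'a} \<le> CARD('a)" by (rule card_mono) auto
  then have q3: "CARD('a) \<ge> 3" using odd by (cases "CARD('a) = 2") auto
  have Ts: "?Ts = map ((`) ut) coords_list" by (simp add: coords_list_def type_coords)
  have len: "length ?Ts = 7" "length (coords_list :: 'a ut_coords set list) = 7" by (simp_all add: coords_list_def)
  have nth: "?Ts ! t = ut ` (coords_list ! t)" if "t < 7" for t
    using that len by (simp only: Ts nth_map)
  have inj: "inj_on (ut :: 'a ut_coords \<Rightarrow> 'a mat) A" for A by (simp add: inj_on_def ut_inj)
  have card_ut: "card (ut ` A) = card A" for A :: "'a ut_coords set" using inj by (rule card_image)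
  have B: "mat_of_rows_list 7 ?rows $$ (s, t) = ?rows ! s ! t" if "s < 7" "t < 7" for s t
    using that by (simp add: mat_of_rows_list_def)
  have main: "is_branching_matrix ?G ?Ts (mat_of_rows_list 7 ?rows)"
  proof (rule is_branching_matrixI[where S = "\<lambda>s t. ut ` (branch_table ! s ! t)"], unfold len)
    show "group ?G" by (rule GT3_group)
    show "finite (carrier ?G)" by (simp add: carrier_GT3)
    show "?Ts \<noteq> []" "?Ts ! 0 = carrier ?G" by (simp_all add: type_C_def)
    show "?Ts ! t \<subseteq> carrier ?G" if "t < 7" for t
    proof -
      have "coords_list ! t \<subseteq> (coords_C :: 'a ut_coords set)"
        using that by (auto simp: less7 coords_list_def coords_defs)
      then show ?thesis using nth[OF that] carrier_GT3 by (metis image_mono)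
    qed
    show "distinct (map card ?Ts)"
      using distinct_card_coords[OF q3] by (simp add: Ts card_ut comp_def)
    show "?Ts ! t = (\<Union>s<7. ut ` (branch_table ! s ! t))" if "t < 7" for t
      unfolding nth[OF that] branch_table_covers[OF that] by (rule image_UN)
    show "?G\<lparr>carrier := centralizer (?G\<lparr>carrier := ?Ts ! t\<rparr>) {h}\<rparr> \<cong> ?G\<lparr>carrier := ?Ts ! s\<rparr>"
      if st: "s < 7" "t < 7" and h: "h \<in> ut ` (branch_table ! s ! t)" for s t h
    proof -
      obtain p where p: "h = ut p" "p \<in> branch_table ! s ! t" using h by blast
      show ?thesis unfolding p(1) nth[OF st(1)] nth[OF st(2)] centralizer_ut
        by (rule coord_iso_imp_iso[OF cent_branch_table[OF two st p(2)]])
    qed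
    show "\<exists>t<s. ut ` (branch_table ! s ! t) \<noteq> ({} :: 'a mat set)" if "0 < s" "s < 7" for s
    proof -
      have m1: "(1 :: 'a) \<noteq> - 1" using two by (metis add.right_inverse one_add_one)
      have "1 \<in> (nonzero :: 'a set)" "(1, - 1) \<in> (nonzero_pairs :: ('a \<times> 'a) set)"
        using m1 by (simp_all add: nonzero_def nonzero_pairs_def)
      then have ne: "(nonzero :: 'a set) \<noteq> {}" "nonzero_pairs \<noteq> ({} :: ('a \<times> 'a) set)" by blast+
      \<comment> \<open>Every type occurs as a branch of the whole group, except that for \<open>q = 3\<close> no element has three
        distinct nonzero eigenvalues; the diagonal group is then reached through \<open>type_B1\<close>.\<close>
      have "branch_table ! s ! (if s = 6 then 3 else 0) \<noteq> ({} :: 'a ut_coords set)"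
        using that ne by (auto simp: less7 branch_table_def elems_defs)
      then show ?thesis using that by (intro exI[of _ "if s = 6 then 3 else 0"]) auto
    qed
    show "mat_of_rows_list 7 ?rows \<in> carrier_mat 7 7"
      by (rule carrier_matI) (simp_all add: mat_of_rows_list_def)
    show "int (card (ut ` (branch_table ! s ! t) :: 'a mat set)) * int (card (?Ts ! s))
        = mat_of_rows_list 7 ?rows $$ (s, t) * int (card (?Ts ! t))" if "s < 7" "t < 7" for s t
      unfolding nth[OF that(1)] nth[OF that(2)] card_ut B[OF that]
      using branch_table_count[OF that, where 'a = 'a] by (simp only: Let_def assms(1))
  qed
  then have "\<exists>H\<in>set ?Ts. has_type ?G gs H" if "commuting_tuple ?G gs" for gs
    using that by (simp only: is_branching_matrix_def lists_types_def)
  then show ?thesis using main by simp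
qed

end
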